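(* Let $B_1=B_1(0)\subset\mathbb{R}^n$ be the open unit ball and let $K>0$. Let $\psi\in C^1(B_1)$ satisfy $\psi\ge(n-2)\frac{\pi}{2}$ on $B_1$ and be semi-concave with $D^2\psi\le KI$ on $B_1$. Let $u\in C^3(\overline{B_1})$ be a solution of $$\sum_{i=1}^n\arctan\lambda_i(x)=\psi(x),\qquad x\in B_1,$$ where $\lambda_1(x),\dots,\lambda_n(x)$ are the eigenvalues of the Hessian $D^2u(x)$. Then $$|Du(0)|\le C(n,K)\left(1+(\operatorname{osc}_{B_1}u)^2\right),$$ where the constant $C(n,K)$ depends only on $n$ and $K$.
   Context: $\operatorname{osc}_{B_1}u=\sup_{B_1}u-\inf_{B_1}u$. For $\psi\in C^1(B_1)$, the semi-concavity condition $D^2\psi\le KI$ means that $x\mapsto\psi(x)-\frac K2|x|^2$ is concave on $B_1$; equivalently $\psi(x)\le\psi(x_0)+(x-x_0)\cdot D\psi(x_0)+\frac K2|x-x_0|^2$ for all $x,x_0\in B_1$. *)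

theory Defs
  imports "HOL-Analysis.Analysis"
begin

definition partial :: "'n::finite \<Rightarrow> (real^'n \<Rightarrow> real) \<Rightarrow> real^'n \<Rightarrow> real" where
  "partial i f x = frechet_derivative f (at x) (axis i 1)"

definition gradient :: "(real^'n::finite \<Rightarrow> real) \<Rightarrow> real^'n \<Rightarrow> real^'n" where
  "gradient f x = (\<chi> i. partial i f x)"

definition hessian :: "(real^'n::finite \<Rightarrow> real) \<Rightarrow> real^'n \<Rightarrow> real^'n^'n" where
  "hessian f x = (\<chi> i j. partial i (partial j f) x)"

text \<open>The space \<open>C\<^sup>k(S)\<close>. Only meant for open \<open>S\<close>, on which \<open>partial\<close>, taken with
  respect to the unrestricted filter \<open>at x\<close>, depends only on the values of \<open>f\<close> on \<open>S\<close>.\<close>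

fun Ck_on :: "nat \<Rightarrow> (real^'n::finite) set \<Rightarrow> (real^'n \<Rightarrow> real) \<Rightarrow> bool" where
  "Ck_on 0 S f \<longleftrightarrow> continuous_on S f"
| "Ck_on (Suc k) S f \<longleftrightarrow>
     continuous_on S f \<and> (\<forall>x\<in>S. f differentiable (at x)) \<and> (\<forall>i. Ck_on k S (partial i f))"

text \<open>The space \<open>C\<^sup>k\<close> of the closure of a bounded open set \<open>S\<close>: functions in \<open>C\<^sup>k(S)\<close> all of
  whose partial derivatives of order at most \<open>k\<close> extend continuously to the closure.
  The values of \<open>f\<close> outside \<open>S\<close> are irrelevant.\<close>

fun Ck_closure :: "nat \<Rightarrow> (real^'n::finite) set \<Rightarrow> (real^'n \<Rightarrow> real) \<Rightarrow> bool" where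
  "Ck_closure 0 S f \<longleftrightarrow> (\<exists>g. continuous_on (closure S) g \<and> (\<forall>x\<in>S. g x = f x))"
| "Ck_closure (Suc k) S f \<longleftrightarrow>
     (\<exists>g. continuous_on (closure S) g \<and> (\<forall>x\<in>S. g x = f x)) \<and>
     (\<forall>x\<in>S. f differentiable (at x)) \<and> (\<forall>i. Ck_closure k S (partial i f))"

text \<open>\<open>eigenvalues_of A l\<close>: the family \<open>l\<close>, indexed like the rows of \<open>A\<close>, lists the eigenvalues
  of \<open>A\<close> repeated according to their algebraic multiplicity. It is thereby determined
  up to a permutation of the indices.\<close>

definition eigenvalues_of :: "real^'n^'n::finite \<Rightarrow> ('n \<Rightarrow> real) \<Rightarrow> bool" where
  "eigenvalues_of A l \<longleftrightarrow> (\<forall>t. det (mat t - A) = (\<Prod>i\<in>UNIV. t - l i))"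

lemma eigenvalues_of_range:
  assumes "eigenvalues_of A l"
  shows "t \<in> range l \<longleftrightarrow> (\<exists>v. v \<noteq> 0 \<and> A *v v = t *\<^sub>R v)"
proof -
  have mat: "mat t *v v = t *\<^sub>R v" for v :: "real^'n"
    by (simp add: matrix_vector_mult_def mat_def vec_eq_iff if_distrib[of "\<lambda>x. x * _"] cong: if_cong)
  have "t \<in> range l \<longleftrightarrow> det (mat t - A) = 0"
    using assms by (auto simp: eigenvalues_of_def)
  also have "\<dots> \<longleftrightarrow> (\<exists>v. v \<noteq> 0 \<and> (mat t - A) *v v = 0)"
    using invertible_det_nz[of "mat t - A"] invertible_left_inverse[of "mat t - A"]
      matrix_left_invertible_ker[of "mat t - A"] by blast
  also have "\<dots> \<longleftrightarrow> (\<exists>v. v \<noteq> 0 \<and> A *v v = t *\<^sub>R v)"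
    by (auto simp: matrix_vector_mult_diff_rdistrib mat)
  finally show ?thesis .
qed

definition osc :: "'a set \<Rightarrow> ('a \<Rightarrow> real) \<Rightarrow> real" where
  "osc S f = (SUP x\<in>S. f x) - (INF x\<in>S. f x)"

text \<open>The condition \<open>D\<^sup>2 f \<le> K I\<close> on \<open>S\<close>, in the sense of semi-concavity.\<close>

definition semiconcave_on :: "(real^'n::finite) set \<Rightarrow> real \<Rightarrow> (real^'n \<Rightarrow> real) \<Rightarrow> bool" where
  "semiconcave_on S K f \<longleftrightarrow> concave_on S (\<lambda>x. f x - K / 2 * (norm x)\<^sup>2)"

end

theory Submission
  imports Defs
begin

text \<open>
  The estimate is a maximum principle argument of Warren--Yuan type. Let \<open>M = 1 + osc u\<close>, shift
  \<open>u\<close> to a function \<open>U\<close> with values in \<open>[M, 2 M]\<close>, put \<open>A = 2 / M\<close> and \<open>\<eta> = 1 - |x|\<^sup>2\<close>, and let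
  \<open>x\<close> be a maximum point of \<open>w = \<eta> |Du| + A U\<^sup>2\<close>. Write \<open>p = |Du(x)|\<close>, \<open>e = Du(x) / p\<close> and
  \<open>W = p \<eta>\<close>. Since \<open>A U\<^sup>2 \<le> 8 M\<close>, a bound for \<open>W\<close> bounds \<open>w\<close> everywhere, in particular
  \<open>|Du(0)|\<close>. At \<open>x\<close> also the smooth function \<open>\<eta> u\<^sub>e + A U\<^sup>2\<close> is maximal.

  The vanishing first derivative gives \<open>\<eta> D\<^sup>2u e = p (2 x - a e)\<close> with \<open>a = 2 A U \<in> [4, 8]\<close>; paired
  with \<open>e\<close> this forces a negative eigenvalue \<open>-\<Lambda>\<close> with \<open>\<Lambda> \<ge> 2 p / \<eta>\<close>. A phase of at least
  \<open>(n - 2) \<pi> / 2\<close> then makes every other eigenvalue at least \<open>\<Lambda>\<close>, and the excess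
  \<open>\<psi> - (n - 2) \<pi> / 2\<close> is at most \<open>1 / \<Lambda> \<le> \<eta> / (2 p)\<close> (\<open>supercritical_phase\<close>). Differentiating
  the equation in direction \<open>e\<close> shows that \<open>u\<^sub>e\<close> solves
  \<open>\<Sum>\<^sub>i (1 + \<lambda>\<^sub>i\<^sup>2)\<^sup>-\<^sup>1 D\<^sub>i\<^sub>i u\<^sub>e = \<psi>\<^sub>e\<close> in an eigenbasis (\<open>phase_derivative\<close>), so the second order
  condition can be summed with the weights \<open>(1 + \<lambda>\<^sub>i\<^sup>2)\<^sup>-\<^sup>1\<close>. The good term comes from \<open>A U\<^sup>2\<close> and is at
  least a multiple of \<open>A \<eta>\<^sup>2\<close>; the error terms are of order \<open>\<eta> / p = \<eta>\<^sup>2 / W\<close>. The last term,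
  \<open>\<eta> \<psi>\<^sub>e\<close>, is controlled because a semi-concave function that is close to a lower bound has small
  slope: \<open>\<psi>\<^sub>e\<close> is at least minus a multiple of \<open>(\<eta> / p)\<^sup>1\<^sup>/\<^sup>2\<close>, and \<open>\<eta> (\<eta> / p)\<^sup>1\<^sup>/\<^sup>2 = \<eta>\<^sup>2 W\<^sup>-\<^sup>1\<^sup>/\<^sup>2\<close>.
  Hence \<open>A W\<^sup>1\<^sup>/\<^sup>2 \<le> C(n, K)\<close> unless \<open>W < 9\<close>, and in both cases \<open>W \<le> C(n, K) M\<^sup>2\<close> (\<open>maximum_point_inequality\<close>,
  \<open>interior_maximum_estimate\<close>).

  The eigenvalues need not depend differentiably on the point, so the phase is differentiated through
  the determinant: \<open>det (I + i D\<^sup>2u) = R e\<^sup>i\<^sup>\<psi>\<close> with \<open>R > 0\<close>, where the left-hand side is polynomial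
  in the entries of the Hessian.
\<close>

section \<open>Calculus along lines and symmetry of second derivatives\<close>

lemma Ck_closure_imp_Ck_on: "Ck_closure k S f \<Longrightarrow> Ck_on k S f"
proof (induction k arbitrary: f)
  case 0
  then obtain g where g: "continuous_on (closure S) g" "\<forall>x\<in>S. g x = f x" by auto
  have "continuous_on S g" by (rule continuous_on_subset[OF g(1) closure_subset])
  then show ?case using g(2) by (simp cong: continuous_on_cong)
next
  case (Suc k)
  then obtain g where g: "continuous_on (closure S) g" "\<forall>x\<in>S. g x = f x" by auto
  have "continuous_on S g" by (rule continuous_on_subset[OF g(1) closure_subset])
  then have "continuous_on S f" using g(2) by (simp cong: continuous_on_cong)
  then show ?case using Suc by auto
qed

lemma has_derivative_partial:
  assumes "f differentiable (at x)"
  shows "(f has_derivative (\<lambda>h. \<Sum>i\<in>UNIV. h $ i * partial i f x)) (at x)"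
proof -
  let ?D = "frechet_derivative f (at x)"
  have D: "(f has_derivative ?D) (at x)"
    using assms frechet_derivative_works by blast
  have lin: "linear ?D" using assms by (rule linear_frechet_derivative)
  have "?D h = (\<Sum>i\<in>UNIV. h $ i * partial i f x)" for h
  proof -
    have "?D h = ?D (\<Sum>i\<in>UNIV. (h $ i) *\<^sub>R axis i 1)"
      using basis_expansion[of h] by (simp add: scalar_mult_eq_scaleR)
    also have "\<dots> = (\<Sum>i\<in>UNIV. h $ i * partial i f x)"
      by (simp add: linear_sum[OF lin] linear_scale[OF lin] partial_def)
    finally show ?thesis .
  qed
  then show ?thesis using D by presburger
qed

lemma has_real_derivative_line:
  assumes "f differentiable (at (x + t *\<^sub>R v))"
  shows "((\<lambda>s. f (x + s *\<^sub>R v)) has_real_derivative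
           (\<Sum>i\<in>UNIV. v $ i * partial i f (x + t *\<^sub>R v))) (at t)"
proof -
  have "((\<lambda>s. x + s *\<^sub>R v) has_derivative (\<lambda>s. s *\<^sub>R v)) (at t)"
    by (auto intro!: derivative_eq_intros)
  from diff_chain_at[OF this has_derivative_partial[OF assms]]
  have "((\<lambda>s. f (x + s *\<^sub>R v)) has_derivative
      (\<lambda>s. \<Sum>i\<in>UNIV. s * (v $ i * partial i f (x + t *\<^sub>R v)))) (at t)"
    by (simp add: o_def mult.assoc)
  then show ?thesis
    by (simp add: has_field_derivative_def flip: sum_distrib_left)
      (simp add: mult_commute_abs)
qed

lemma has_real_derivative_axis:
  assumes "f differentiable (at (x + t *\<^sub>R axis i 1))"
  shows "((\<lambda>s. f (x + s *\<^sub>R axis i 1)) has_real_derivative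
           partial i f (x + t *\<^sub>R axis i 1)) (at t)"
proof -
  have "(\<Sum>j\<in>UNIV. axis i 1 $ j * partial j f y) = partial i f y" for y
    by (simp add: axis_def if_distrib[of "\<lambda>c. c * _"] cong: if_cong)
  then show ?thesis using has_real_derivative_line[OF assms] by simp
qed

text \<open>The mean value theorem, once in each coordinate direction. The left-hand side is symmetric in
  \<open>i\<close> and \<open>j\<close>, which is what makes mixed partial derivatives commute.\<close>

lemma double_difference_mean_value:
  assumes f: "\<And>y. y \<in> ball x r \<Longrightarrow> f differentiable (at y)"
    and fi: "\<And>y. y \<in> ball x r \<Longrightarrow> partial i f differentiable (at y)"
    and h: "0 < h" "2 * h < r"
  shows "\<exists>y. dist x y < 2 * h \<and>
    f (x + h *\<^sub>R axis i 1 + h *\<^sub>R axis j 1) - f (x + h *\<^sub>R axis i 1)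
      - f (x + h *\<^sub>R axis j 1) + f x = h * (h * partial j (partial i f) y)"
proof -
  let ?a = "axis i 1 :: real^'a" and ?b = "axis j 1 :: real^'a"
  have dist_le: "dist x (x + s *\<^sub>R ?a + t *\<^sub>R ?b) \<le> s + t" if "0 \<le> s" "0 \<le> t" for s t
  proof -
    have "dist x (x + s *\<^sub>R ?a + t *\<^sub>R ?b) = norm (s *\<^sub>R ?a + t *\<^sub>R ?b)"
      by (subst dist_commute) (simp add: dist_norm add.assoc)
    also have "\<dots> \<le> s + t"
      using norm_triangle_ineq[of "s *\<^sub>R ?a" "t *\<^sub>R ?b"] that by simp
    finally show ?thesis .
  qed
  have in_ball: "x + s *\<^sub>R ?a + t *\<^sub>R ?b \<in> ball x r" if "0 \<le> s" "s \<le> h" "0 \<le> t" "t \<le> h" for s t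
    using dist_le[OF that(1,3)] that h by simp
  define G where "G s = f (x + h *\<^sub>R ?b + s *\<^sub>R ?a) - f (x + s *\<^sub>R ?a)" for s
  have G': "(G has_real_derivative partial i f (x + h *\<^sub>R ?b + s *\<^sub>R ?a) - partial i f (x + s *\<^sub>R ?a)) (at s)"
    if "0 \<le> s" "s \<le> h" for s
    unfolding G_def using that in_ball[of s h] in_ball[of s 0] h
    by (intro DERIV_diff has_real_derivative_axis f) (auto simp: add_ac)
  obtain s where s: "0 < s" "s < h"
    and Gs: "G h - G 0 = (h - 0) * (partial i f (x + h *\<^sub>R ?b + s *\<^sub>R ?a) - partial i f (x + s *\<^sub>R ?a))"
    using MVT2[OF h(1) G'] by blast
  have P': "((\<lambda>t. partial i f (x + s *\<^sub>R ?a + t *\<^sub>R ?b)) has_real_derivative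
      partial j (partial i f) (x + s *\<^sub>R ?a + t *\<^sub>R ?b)) (at t)" if "0 \<le> t" "t \<le> h" for t
    using that in_ball[of s t] s by (intro has_real_derivative_axis fi) auto
  obtain t where t: "0 < t" "t < h"
    and Pt: "partial i f (x + s *\<^sub>R ?a + h *\<^sub>R ?b) - partial i f (x + s *\<^sub>R ?a + 0 *\<^sub>R ?b)
      = (h - 0) * partial j (partial i f) (x + s *\<^sub>R ?a + t *\<^sub>R ?b)"
    using MVT2[OF h(1) P'] by blast
  have "dist x (x + s *\<^sub>R ?a + t *\<^sub>R ?b) < 2 * h"
    using dist_le[of s t] s t by simp
  moreover have "G h - G 0 = h * (h * partial j (partial i f) (x + s *\<^sub>R ?a + t *\<^sub>R ?b))"
    using Gs Pt by (simp add: add_ac)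
  ultimately show ?thesis
    by (intro exI[of _ "x + s *\<^sub>R ?a + t *\<^sub>R ?b"]) (simp add: G_def add_ac)
qed

lemma partial_commute:
  assumes S: "open S" "x \<in> S" and f: "Ck_on (Suc (Suc k)) S f"
  shows "partial i (partial j f) x = partial j (partial i f) x"
proof (rule ccontr)
  assume ne: "partial i (partial j f) x \<noteq> partial j (partial i f) x"
  define \<epsilon> where "\<epsilon> = dist (partial i (partial j f) x) (partial j (partial i f) x) / 2"
  have \<epsilon>: "\<epsilon> > 0" using ne by (simp add: \<epsilon>_def)
  have cont0: "Ck_on 0 S (partial i' (partial j' f))" for i' j'
    using f by (cases k) auto
  have "\<exists>d>0. \<forall>y. dist y x < d \<longrightarrow> dist (partial i' (partial j' f) y) (partial i' (partial j' f) x) < \<epsilon>"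
    for i' j'
  proof -
    have "isCont (partial i' (partial j' f)) x"
      using cont0 S by (simp add: continuous_on_eq_continuous_at)
    then show ?thesis using \<epsilon> by (simp add: continuous_at_eps_delta dist_norm)
  qed
  then obtain d1 d2 where d: "d1 > 0" "d2 > 0"
    and d1: "\<And>y. dist y x < d1 \<Longrightarrow> dist (partial i (partial j f) y) (partial i (partial j f) x) < \<epsilon>"
    and d2: "\<And>y. dist y x < d2 \<Longrightarrow> dist (partial j (partial i f) y) (partial j (partial i f) x) < \<epsilon>"
    by meson
  obtain r where r: "r > 0" "ball x r \<subseteq> S" using S openE by blast
  define h where "h = min (min d1 d2) r / 4"
  have h: "0 < h" "2 * h < r" "2 * h < d1" "2 * h < d2"
    using d r by (auto simp: h_def min_def)
  have df: "f differentiable (at y)" "partial l f differentiable (at y)" if "y \<in> ball x r" for l y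
    using f that r by (auto simp: subset_iff)
  from double_difference_mean_value[of x r f i h j] df h obtain y where y: "dist x y < 2 * h"
    "f (x + h *\<^sub>R axis i 1 + h *\<^sub>R axis j 1) - f (x + h *\<^sub>R axis i 1)
      - f (x + h *\<^sub>R axis j 1) + f x = h * (h * partial j (partial i f) y)" by blast
  from double_difference_mean_value[of x r f j h i] df h obtain z where z: "dist x z < 2 * h"
    "f (x + h *\<^sub>R axis j 1 + h *\<^sub>R axis i 1) - f (x + h *\<^sub>R axis j 1)
      - f (x + h *\<^sub>R axis i 1) + f x = h * (h * partial i (partial j f) z)" by blast
  have swap: "x + h *\<^sub>R axis i 1 + h *\<^sub>R axis j 1 = x + h *\<^sub>R axis j 1 + h *\<^sub>R axis i 1"
    by (simp add: add_ac)
  have "h * (h * partial j (partial i f) y) = h * (h * partial i (partial j f) z)"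
    using y(2)[unfolded swap] z(2) by linarith
  then have eq: "partial j (partial i f) y = partial i (partial j f) z" using h by simp
  have "dist (partial i (partial j f) z) (partial i (partial j f) x) < \<epsilon>"
    using d1[of z] z(1) h dist_commute[of x z] by linarith
  moreover have "dist (partial j (partial i f) y) (partial j (partial i f) x) < \<epsilon>"
    using d2[of y] y(1) h dist_commute[of x y] by linarith
  ultimately show False using eq dist_triangle3[of "partial i (partial j f) x" "partial j (partial i f) x" "partial i (partial j f) z"]
    unfolding \<epsilon>_def by simp
qed

lemma second_derivative_test_max:
  fixes \<phi> \<phi>' :: "real \<Rightarrow> real"
  assumes \<delta>: "\<delta> > 0"
    and d1: "\<And>t. \<bar>t\<bar> < \<delta> \<Longrightarrow> (\<phi> has_real_derivative \<phi>' t) (at t)"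
    and d2: "(\<phi>' has_real_derivative D) (at 0)"
    and max: "\<And>t. \<bar>t\<bar> < \<delta> \<Longrightarrow> \<phi> t \<le> \<phi> 0"
  shows "\<phi>' 0 = 0" "D \<le> 0"
proof -
  show z: "\<phi>' 0 = 0"
    by (rule DERIV_local_max[OF d1[of 0] \<delta>]) (use max \<delta> in auto)
  show "D \<le> 0"
  proof (rule ccontr)
    assume "\<not> D \<le> 0"
    then obtain d where d: "d > 0" "\<And>h. 0 < h \<Longrightarrow> h < d \<Longrightarrow> \<phi>' 0 < \<phi>' h"
      using DERIV_pos_inc_right[OF d2] by auto
    define h where "h = min d \<delta> / 2"
    have h: "0 < h" "h < d" "h < \<delta>" using d \<delta> by (auto simp: h_def min_def)
    obtain s where s: "0 < s" "s < h" "\<phi> h - \<phi> 0 = (h - 0) * \<phi>' s"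
      using MVT2[of 0 h \<phi> \<phi>'] d1 h by auto
    have "0 < h * \<phi>' s" using d(2)[of s] s h z by simp
    then show False using s(3) max[of h] h by simp
  qed
qed

section \<open>Spectral theorem and characteristic polynomial\<close>

text \<open>A maximiser of the quadratic form on the unit sphere of an invariant subspace is an eigenvector.\<close>

lemma symmetric_eigenvector_in_subspace:
  fixes A :: "real^'n^'n"
  assumes sym: "transpose A = A"
    and S: "subspace S" "S \<noteq> {0}" and inv: "\<And>x. x \<in> S \<Longrightarrow> A *v x \<in> S"
  obtains v \<mu> where "v \<in> S" "norm v = 1" "A *v v = \<mu> *\<^sub>R v"
proof -
  define q where "q x = x \<bullet> (A *v x)" for x
  have symd: "x \<bullet> (A *v y) = (A *v x) \<bullet> y" for x y
    using sym dot_lmul_matrix[of x A y] by (metis transpose_matrix_vector)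
  obtain z where z: "z \<in> S" "z \<noteq> 0" using S subspace_0 by blast
  have "compact (sphere 0 1 \<inter> S)"
    by (intro compact_Int_closed closed_subspace S) simp
  moreover have "(1 / norm z) *\<^sub>R z \<in> sphere 0 1 \<inter> S"
    using z S by (simp add: subspace_scale)
  moreover have "continuous_on (sphere 0 1 \<inter> S) q"
    unfolding q_def by (intro continuous_intros)
  ultimately obtain v where v: "v \<in> sphere 0 1 \<inter> S" and max: "\<And>y. y \<in> sphere 0 1 \<inter> S \<Longrightarrow> q y \<le> q v"
    using continuous_attains_sup[of "sphere 0 1 \<inter> S" q] by blast
  have le: "q y \<le> q v * (y \<bullet> y)" if "y \<in> S" for y
  proof (cases "y = 0")
    case False
    have "q ((1 / norm y) *\<^sub>R y) \<le> q v"
      by (rule max) (use that S False in \<open>simp add: subspace_scale\<close>)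
    then show ?thesis using False
      by (simp add: q_def matrix_vector_mult_scaleR dot_square_norm power2_eq_square field_simps)
  qed (simp add: q_def)
  have vv: "v \<bullet> v = 1" "v \<in> S" using v by (auto simp: dot_square_norm)
  define w where "w = A *v v - q v *\<^sub>R v"
  have wS: "w \<in> S" using vv inv S by (simp add: w_def subspace_diff subspace_scale)
  \<comment> \<open>The form \<open>q v * (y \<bullet> y) - q y\<close> is nonnegative on \<open>S\<close> and vanishes at \<open>v\<close>, so its
    derivative at \<open>v\<close> in the direction \<open>w\<close>, namely \<open>- 2 * (w \<bullet> w)\<close>, must vanish.\<close>
  have quad: "0 \<le> t * (- 2 * (w \<bullet> w)) + t\<^sup>2 * (q v * (w \<bullet> w) - q w)" for t
  proof -
    have e1: "q (v + t *\<^sub>R w) = q v + 2 * t * (w \<bullet> (A *v v)) + t\<^sup>2 * q w"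
      using symd[of v w]
      by (simp add: q_def matrix_vector_right_distrib matrix_vector_mult_scaleR inner_add_left
          inner_add_right power2_eq_square algebra_simps inner_commute)
    have e2: "(v + t *\<^sub>R w) \<bullet> (v + t *\<^sub>R w) = 1 + 2 * t * (w \<bullet> v) + t\<^sup>2 * (w \<bullet> w)"
      using vv by (simp add: inner_add_left inner_add_right power2_eq_square algebra_simps inner_commute)
    have e3: "w \<bullet> (A *v v) = w \<bullet> w + q v * (w \<bullet> v)"
      by (simp add: w_def inner_diff_right inner_diff_left inner_commute algebra_simps)
    have "q (v + t *\<^sub>R w) \<le> q v * ((v + t *\<^sub>R w) \<bullet> (v + t *\<^sub>R w))"
      by (rule le) (use vv wS S in \<open>simp add: subspace_add subspace_scale\<close>)
    then show ?thesis unfolding e1 e2 e3 by (simp add: algebra_simps)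
  qed
  have "w \<bullet> w = 0"
  proof (rule ccontr)
    assume "w \<bullet> w \<noteq> 0"
    then have pos: "w \<bullet> w > 0" by simp
    define c where "c = \<bar>q v * (w \<bullet> w) - q w\<bar> + 1"
    define t where "t = (w \<bullet> w) / c"
    have c: "c > 0" "q v * (w \<bullet> w) - q w \<le> c" by (auto simp: c_def)
    have "0 \<le> t * (- 2 * (w \<bullet> w)) + t\<^sup>2 * c"
      using quad[of t] mult_left_mono[OF c(2), of "t\<^sup>2"] by simp
    also have "\<dots> = - (w \<bullet> w)\<^sup>2 / c" using c by (simp add: t_def power2_eq_square field_simps)
    also have "\<dots> < 0" using pos c by (simp add: divide_neg_pos)
    finally show False by simp
  qed
  then have "A *v v = q v *\<^sub>R v" by (simp add: w_def)
  then show thesis using that vv v by auto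
qed

text \<open>An orthonormal set of eigenvectors of maximal cardinality is a basis: its orthogonal complement is
  invariant, so a nonzero complement would contain one more eigenvector.\<close>

lemma spectral_theorem:
  fixes A :: "real^'n^'n"
  assumes sym: "transpose A = A"
  obtains v :: "'n \<Rightarrow> real^'n" and \<mu> where
    "\<And>i j. v i \<bullet> v j = (if i = j then 1 else 0)" "\<And>i. A *v v i = \<mu> i *\<^sub>R v i"
proof -
  define P where "P B \<longleftrightarrow> finite B \<and> pairwise orthogonal B \<and>
    (\<forall>b\<in>B. norm b = 1 \<and> (\<exists>c. A *v b = c *\<^sub>R b))" for B :: "(real^'n) set"
  have indep: "independent B" if "P B" for B
    using that unfolding P_def by (intro pairwise_orthogonal_independent) auto
  have "P {}" by (simp add: P_def)
  moreover have "\<forall>B. P B \<longrightarrow> card B < Suc (CARD('n))"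
    using independent_card_le[OF indep] by (auto simp: less_Suc_eq_le)
  ultimately obtain B where B: "P B" and Bmax: "\<And>B'. P B' \<Longrightarrow> card B' \<le> card B"
    using ex_has_greatest_nat[of P "{}" card "Suc (CARD('n))"] by blast
  define S where "S = {x. \<forall>b\<in>B. orthogonal x b}"
  have S: "subspace S"
    by (auto simp: S_def subspace_def orthogonal_clauses orthogonal_def inner_add_left)
  have symd: "x \<bullet> (A *v y) = (A *v x) \<bullet> y" for x y
    using sym dot_lmul_matrix[of x A y] by (metis transpose_matrix_vector)
  have inv: "A *v x \<in> S" if "x \<in> S" for x
    using that B by (force simp: S_def P_def orthogonal_def simp flip: symd)
  have "S = {0}"
  proof (rule ccontr)
    assume "S \<noteq> {0}"
    from symmetric_eigenvector_in_subspace[OF sym S this inv] obtain v \<mu> where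
      v: "v \<in> S" "norm v = 1" "A *v v = \<mu> *\<^sub>R v" by blast
    have "v \<notin> B" using v by (auto simp: S_def orthogonal_def norm_eq_1)
    moreover have "P (insert v B)"
      using B v by (auto simp: P_def S_def pairwise_insert orthogonal_commute)
    ultimately show False using Bmax[of "insert v B"] B by (simp add: P_def)
  qed
  have "card B = CARD('n)"
  proof -
    have "span B = UNIV"
    proof (rule ccontr)
      assume "span B \<noteq> UNIV"
      then obtain a where "a \<noteq> 0" "\<forall>x\<in>span B. a \<bullet> x = 0"
        using span_not_UNIV_orthogonal by blast
      then have "a \<in> S" by (auto simp: S_def orthogonal_def span_base)
      then show False using \<open>S = {0}\<close> \<open>a \<noteq> 0\<close> by auto
    qed
    then show ?thesis using indep[OF B] by (metis dim_UNIV dim_eq_card dim_span DIM_cart DIM_real mult.right_neutral)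
  qed
  then obtain v where v: "bij_betw v (UNIV :: 'n set) B"
    using B finite_same_card_bij[of "UNIV :: 'n set" B] by (auto simp: P_def)
  have "v i \<bullet> v j = (if i = j then 1 else 0)" for i j
  proof -
    have "v i \<in> B" "v j \<in> B" "v i = v j \<longleftrightarrow> i = j"
      using v by (auto simp: bij_betw_def inj_on_def)
    then show ?thesis using B by (auto simp: P_def pairwise_def orthogonal_def norm_eq_1)
  qed
  moreover have "\<exists>c. A *v v i = c *\<^sub>R v i" for i
    using v B by (auto simp: P_def bij_betw_def)
  ultimately show thesis using that by metis
qed

lemma orthonormal_expansion:
  fixes v :: "'n \<Rightarrow> real^'n"
  assumes v: "\<And>i j. v i \<bullet> v j = (if i = j then 1 else 0)"
  shows "x \<bullet> y = (\<Sum>i\<in>UNIV. (x \<bullet> v i) * (y \<bullet> v i))"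
proof -
  define Q where "Q = (\<chi> i j. v i $ j)"
  have "orthogonal_matrix Q"
    using v by (auto simp: Q_def orthogonal_matrix_orthonormal_rows row_def norm_eq_1 orthogonal_def)
  then have "orthogonal_transformation ((*v) Q)"
    by (simp add: orthogonal_transformation_matrix)
  then have "(Q *v x) \<bullet> (Q *v y) = x \<bullet> y"
    by (simp add: orthogonal_transformation_def)
  then show ?thesis
    by (simp add: Q_def matrix_vector_mult_def inner_vec_def mult.commute)
qed

lemma eigenvalues_of_orthonormal_basis:
  fixes v :: "'n \<Rightarrow> real^'n"
  assumes v: "\<And>i j. v i \<bullet> v j = (if i = j then 1 else 0)"
    and l: "eigenvalues_of A l"
  shows "eigenvalues_of (\<chi> i j. v i \<bullet> (A *v v j)) l"
  unfolding eigenvalues_of_def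
proof
  fix t
  define Q where "Q = (\<chi> i j. v i $ j)"
  have orth: "orthogonal_matrix Q"
    using v by (auto simp: Q_def orthogonal_matrix_orthonormal_rows row_def norm_eq_1 orthogonal_def)
  have "(Q ** (A ** transpose Q)) $ i $ j = v i \<bullet> (A *v v j)" for i j
    by (simp add: Q_def matrix_matrix_mult_def matrix_vector_mult_def transpose_def inner_vec_def)
  then have eq: "(\<chi> i j. v i \<bullet> (A *v v j)) = Q ** (A ** transpose Q)"
    by (simp add: vec_eq_iff)
  have matm: "Q ** (mat t ** transpose Q) = mat t"
  proof -
    have "(mat t :: real^'n^'n) = t *\<^sub>R mat 1"
      by (simp add: mat_def vec_eq_iff)
    then have "Q ** (mat t ** transpose Q) = t *\<^sub>R (Q ** transpose Q)"
      by (simp add: matrix_scalar_ac flip: scalar_matrix_assoc)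
    then show ?thesis using orth by (simp add: orthogonal_matrix_def mat_def vec_eq_iff)
  qed
  have "mat t - (\<chi> i j. v i \<bullet> (A *v v j)) = Q ** ((mat t - A) ** transpose Q)"
    unfolding eq by (subst matm[symmetric])
      (simp add: matrix_matrix_mult_def vec_eq_iff sum_subtractf algebra_simps)
  then have "det (mat t - (\<chi> i j. v i \<bullet> (A *v v j))) = det Q * (det (mat t - A) * det Q)"
    by (simp add: det_mul)
  also have "\<dots> = det (mat t - A)"
    using det_orthogonal_matrix[OF orth] by auto
  finally show "det (mat t - (\<chi> i j. v i \<bullet> (A *v v j))) = (\<Prod>i\<in>UNIV. t - l i)"
    using l by (simp add: eigenvalues_of_def)
qed

lemma eigenvalues_of_diagonal:
  "eigenvalues_of (\<chi> i j. if i = j then \<mu> i else 0) \<mu>"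
  unfolding eigenvalues_of_def
  by (subst det_diagonal) (auto simp: mat_def)

lemma poly_det:
  "poly (det M) z = det (\<chi> i j. poly (M $ i $ j) z)"
  by (simp add: det_def poly_sum poly_prod)

text \<open>The definition of the eigenvalues compares determinants at real arguments only. As an identity of
  polynomials it can be evaluated at the imaginary unit and it determines the roots with multiplicity.\<close>

lemma eigenvalues_of_char_poly:
  assumes "eigenvalues_of A l"
  shows "det (\<chi> i j. (if i = j then [:0, 1:] else 0) - [:of_real (A $ i $ j):])
         = (\<Prod>i\<in>UNIV. [:- of_real (l i), 1 :: 'a::{real_normed_field}:])" (is "?p = ?q")
proof -
  have "poly ?p (of_real t) = poly ?q (of_real t)" for t
  proof -
    have "poly ?p (of_real t) = det (\<chi> i j. of_real ((mat t - A) $ i $ j))"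
      unfolding poly_det by (intro arg_cong[of _ _ det]) (simp add: vec_eq_iff mat_def)
    also have "\<dots> = of_real (det (mat t - A))"
      by (simp add: det_def)
    also have "\<dots> = poly ?q (of_real t)"
      using assms by (simp add: eigenvalues_of_def poly_prod)
    finally show ?thesis .
  qed
  then have "range of_real \<subseteq> {z. poly (?p - ?q) z = 0}" by auto
  moreover have "infinite (range (of_real :: real \<Rightarrow> 'a))"
    using inj_of_real infinite_UNIV_char_0 finite_imageD by blast
  ultimately have "?p - ?q = 0" using poly_roots_finite finite_subset by blast
  then show ?thesis by simp
qed

lemma eigenvalues_of_sum_unique:
  assumes "eigenvalues_of A l" "eigenvalues_of A \<mu>"
  shows "(\<Sum>i\<in>UNIV. f (l i)) = (\<Sum>i\<in>UNIV. f (\<mu> i))"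
proof -
  have "proots (\<Prod>i\<in>UNIV. [:- l i, 1:]) = image_mset l (mset_set UNIV)" for l :: "'a \<Rightarrow> real"
    by (subst proots_prod) (auto simp: sum_unfold_sum_mset)
  moreover have "(\<Prod>i\<in>UNIV. [:- l i, 1:]) = (\<Prod>i\<in>UNIV. [:- \<mu> i, 1:])"
    using eigenvalues_of_char_poly[OF assms(1), where 'a = real]
      eigenvalues_of_char_poly[OF assms(2), where 'a = real] by simp
  ultimately have "image_mset l (mset_set UNIV) = image_mset \<mu> (mset_set UNIV)" by metis
  then have "image_mset f (image_mset l (mset_set UNIV)) = image_mset f (image_mset \<mu> (mset_set UNIV))"
    by simp
  then show ?thesis
    by (simp add: sum_unfold_sum_mset multiset.map_comp o_def)
qed

text \<open>The characteristic polynomial evaluated at \<open>\<i>\<close>, because \<open>I + \<i> A = -\<i> (\<i> I - A)\<close>.\<close>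

lemma det_one_plus_ii:
  assumes "eigenvalues_of A l"
  shows "det (\<chi> i j. (if i = j then 1 else 0) + \<i> * of_real (A $ i $ j)) = (\<Prod>i\<in>UNIV. 1 + \<i> * of_real (l i))"
proof -
  have "det (\<chi> i j. (if i = j then 1 else 0) + \<i> * of_real (A $ i $ j))
      = det (\<chi> i j. (-\<i>) * ((if i = j then \<i> else 0) - of_real (A $ i $ j)))"
    by (intro arg_cong[of _ _ det]) (auto simp: vec_eq_iff algebra_simps)
  also have "\<dots> = (-\<i>) ^ CARD('a) * det (\<chi> i j. (if i = j then \<i> else 0) - of_real (A $ i $ j))"
    unfolding det_def sum_distrib_left
    by (intro sum.cong refl)
      (simp only: vec_lambda_beta prod.distrib prod_constant mult.left_commute)
  also have "det (\<chi> i j. (if i = j then \<i> else 0) - of_real (A $ i $ j)) = (\<Prod>i\<in>UNIV. \<i> - of_real (l i))"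
  proof -
    have "poly (det (\<chi> i j. (if i = j then [:0, 1:] else 0) - [:of_real (A $ i $ j):])) \<i>
      = poly (\<Prod>i\<in>UNIV. [:- of_real (l i), 1:]) \<i>"
      using eigenvalues_of_char_poly[OF assms, where 'a = complex] by simp
    then show ?thesis by (simp add: poly_det poly_prod if_distrib[of "\<lambda>p. poly p _"] cong: if_cong)
  qed
  also have "(-\<i>) ^ CARD('a) * (\<Prod>i\<in>UNIV. \<i> - of_real (l i)) = (\<Prod>i\<in>UNIV. (-\<i>) * (\<i> - of_real (l i)))"
    by (simp only: prod.distrib prod_constant)
  also have "\<dots> = (\<Prod>i\<in>UNIV. 1 + \<i> * of_real (l i))"
    by (simp add: algebra_simps)
  finally show ?thesis .
qed

section \<open>The linearised phase operator\<close>

lemma prod_one_plus_ii: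
  "(\<Prod>i\<in>UNIV. 1 + \<i> * of_real (l i))
     = of_real (\<Prod>i\<in>UNIV. sqrt (1 + (l i)\<^sup>2)) * cis (\<Sum>i\<in>(UNIV::'n::finite set). arctan (l i))"
proof -
  have "1 + \<i> * of_real y = of_real (sqrt (1 + y\<^sup>2)) * cis (arctan y)" for y
  proof -
    have "sqrt (1 + y\<^sup>2) > 0" by (simp add: add_pos_nonneg)
    then show ?thesis by (simp add: complex_eq_iff cos_arctan sin_arctan)
  qed
  then have "(\<Prod>i\<in>UNIV. 1 + \<i> * of_real (l i))
      = (\<Prod>i\<in>UNIV. of_real (sqrt (1 + (l i)\<^sup>2)) * cis (arctan (l i)))" by simp
  also have "\<dots> = of_real (\<Prod>i\<in>UNIV. sqrt (1 + (l i)\<^sup>2)) * (\<Prod>i\<in>UNIV. cis (arctan (l i)))"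
    by (simp add: prod.distrib)
  also have "(\<Prod>i\<in>(UNIV::'n set). cis (arctan (l i))) = cis (\<Sum>i\<in>UNIV. arctan (l i))"
    by (simp add: cis_conv_exp exp_sum sum_distrib_left)
  finally show ?thesis .
qed

lemma has_vector_derivative_det_at_diagonal:
  fixes M :: "real \<Rightarrow> complex^'n^'n"
  assumes M': "\<And>i j. ((\<lambda>t. M t $ i $ j) has_vector_derivative N i j) (at s)"
    and diag: "\<And>i j. i \<noteq> j \<Longrightarrow> M s $ i $ j = 0"
  shows "((\<lambda>t. det (M t)) has_vector_derivative
           (\<Sum>i\<in>UNIV. N i i * (\<Prod>j\<in>UNIV - {i}. M s $ j $ j))) (at s)"
proof -
  define T where "T p = (\<Sum>i\<in>UNIV. N i (p i) * (\<Prod>j\<in>UNIV - {i}. M s $ j $ p j))" for p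
  have "((\<lambda>t. \<Prod>i\<in>UNIV. M t $ i $ p i) has_vector_derivative T p) (at s)" for p
  proof -
    have "((\<lambda>t. \<Prod>i\<in>UNIV. M t $ i $ p i) has_derivative
      (\<lambda>y. \<Sum>i\<in>UNIV. (y *\<^sub>R N i (p i)) * (\<Prod>j\<in>UNIV - {i}. M s $ j $ p j))) (at s)"
      using M' by (intro has_derivative_prod) (simp add: has_vector_derivative_def)
    then show ?thesis
      by (simp add: has_vector_derivative_def T_def scaleR_sum_right)
  qed
  then have D: "((\<lambda>t. det (M t)) has_vector_derivative
      (\<Sum>p\<in>{p. p permutes UNIV}. of_int (sign p) * T p)) (at s)"
    unfolding det_def by (intro has_vector_derivative_sum has_vector_derivative_mult_right)
  \<comment> \<open>A permutation other than the identity moves at least two indices, and each of them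
    contributes an off-diagonal factor.\<close>
  have T0: "T p = 0" if p: "p permutes UNIV" "p \<noteq> id" for p
    unfolding T_def
  proof (intro sum.neutral ballI)
    fix i
    obtain k where k: "p k \<noteq> k" using p(2) by (auto simp: fun_eq_iff)
    have "p (p k) \<noteq> p k" using k p(1) by (metis permutes_inj injD)
    then obtain j where "j \<noteq> i" "p j \<noteq> j" using k by metis
    then have "(\<Prod>j\<in>UNIV - {i}. M s $ j $ p j) = 0"
      using diag[of j "p j"] by (intro prod_zero) auto
    then show "N i (p i) * (\<Prod>j\<in>UNIV - {i}. M s $ j $ p j) = 0" by simp
  qed
  have "(\<Sum>p\<in>{p. p permutes UNIV}. of_int (sign p) * T p) = (\<Sum>p\<in>{id}. of_int (sign p) * T p)"
    using T0 by (intro sum.mono_neutral_right) (auto simp: permutes_id)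
  also have "\<dots> = T id" by (simp add: sign_id)
  finally show ?thesis using D by (simp add: T_def)
qed

text \<open>The linearisation of the phase \<open>\<Sum>\<^sub>i arctan \<lambda>\<^sub>i\<close> at a diagonal matrix. The identity
  \<open>det (I + \<i> A) = R e\<^sup>\<i>\<^sup>\<theta>\<close> with \<open>R > 0\<close> says that \<open>det (I + \<i> A) e\<^sup>-\<^sup>\<i>\<^sup>\<theta>\<close> is real, and the vanishing
  derivative of its imaginary part determines \<open>\<theta>'\<close>. The numbering of the eigenvalues \<open>l t\<close> may
  jump with \<open>t\<close>.\<close>

lemma phase_derivative:
  fixes A :: "real \<Rightarrow> real^'n^'n" and l :: "real \<Rightarrow> 'n \<Rightarrow> real"
  assumes \<delta>: "\<delta> > 0" and l: "\<And>t. \<bar>t\<bar> < \<delta> \<Longrightarrow> eigenvalues_of (A t) (l t)"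
    and \<theta>': "((\<lambda>t. \<Sum>i\<in>UNIV. arctan (l t i)) has_real_derivative \<theta>') (at 0)"
    and A': "\<And>i j. ((\<lambda>t. A t $ i $ j) has_real_derivative N i j) (at 0)"
    and diag: "A 0 = (\<chi> i j. if i = j then \<mu> i else 0)"
  shows "\<theta>' = (\<Sum>i\<in>UNIV. N i i / (1 + (\<mu> i)\<^sup>2))"
proof -
  define \<theta> where "\<theta> t = (\<Sum>i\<in>UNIV. arctan (l t i))" for t
  define R where "R t = (\<Prod>i\<in>UNIV. sqrt (1 + (l t i)\<^sup>2))" for t
  define M :: "real \<Rightarrow> complex^'n^'n"
    where "M t = (\<chi> i j. (if i = j then 1 else 0) + \<i> * of_real (A t $ i $ j))" for t
  define Q where "Q = (\<Sum>i\<in>UNIV. of_real (N i i) / (1 + \<i> * of_real (\<mu> i)))"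
  have M': "((\<lambda>t. M t $ i $ j) has_vector_derivative \<i> * of_real (N i j)) (at 0)" for i j
  proof -
    have "((\<lambda>t. (if i = j then 1 else 0) + \<i> * of_real (A t $ i $ j))
        has_vector_derivative 0 + \<i> * of_real (N i j)) (at 0)"
      by (intro has_vector_derivative_add has_vector_derivative_const has_vector_derivative_mult_right
          has_vector_derivative_of_real A')
    then show ?thesis by (simp add: M_def)
  qed
  have Mdiag: "M 0 $ i $ j = (if i = j then 1 + \<i> * of_real (\<mu> i) else 0)" for i j
    by (simp add: M_def diag)
  have nz: "1 + \<i> * of_real y \<noteq> 0" for y :: real
    by (simp add: complex_eq_iff)
  have "((\<lambda>t. det (M t)) has_vector_derivative
      (\<Sum>i\<in>UNIV. \<i> * of_real (N i i) * (\<Prod>j\<in>UNIV - {i}. M 0 $ j $ j))) (at 0)"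
    by (rule has_vector_derivative_det_at_diagonal[OF M']) (simp add: Mdiag)
  also have "(\<Sum>i\<in>UNIV. \<i> * of_real (N i i) * (\<Prod>j\<in>UNIV - {i}. M 0 $ j $ j)) = \<i> * det (M 0) * Q"
  proof -
    have "det (M 0) = (\<Prod>j\<in>UNIV. M 0 $ j $ j)"
      by (rule det_diagonal) (simp add: Mdiag)
    also have "\<dots> = (1 + \<i> * of_real (\<mu> i)) * (\<Prod>j\<in>UNIV - {i}. M 0 $ j $ j)" for i
      by (subst prod.remove[of _ i]) (auto simp: Mdiag)
    finally have "(\<Prod>j\<in>UNIV - {i}. M 0 $ j $ j) = det (M 0) / (1 + \<i> * of_real (\<mu> i))" for i
      using nz by (simp add: eq_divide_eq mult.commute)
    then show ?thesis by (simp add: Q_def sum_distrib_left mult_ac)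
  qed
  finally have D': "((\<lambda>t. det (M t)) has_vector_derivative \<i> * det (M 0) * Q) (at 0)" .
  have "((\<lambda>t. - \<i> * of_real (\<theta> t)) has_vector_derivative - \<i> * of_real \<theta>') (at 0)"
    using \<theta>'[folded \<theta>_def]
    by (intro has_vector_derivative_mult_right has_vector_derivative_of_real)
  from field_vector_diff_chain_at[OF this DERIV_exp]
  have "((\<lambda>t. exp (- \<i> * of_real (\<theta> t))) has_vector_derivative
      - \<i> * of_real \<theta>' * exp (- \<i> * of_real (\<theta> 0))) (at 0)" by (simp add: o_def)
  from has_vector_derivative_mult[OF D' this]
  have "((\<lambda>t. det (M t) * exp (- \<i> * of_real (\<theta> t))) has_vector_derivative
      det (M 0) * exp (- \<i> * of_real (\<theta> 0)) * (\<i> * (Q - of_real \<theta>'))) (at 0)"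
    by (simp add: algebra_simps)
  moreover have real: "det (M t) * exp (- \<i> * of_real (\<theta> t)) = of_real (R t)" if "\<bar>t\<bar> < \<delta>" for t
  proof -
    have "det (M t) = of_real (R t) * cis (\<theta> t)"
      unfolding M_def R_def \<theta>_def det_one_plus_ii[OF l[OF that]] by (rule prod_one_plus_ii)
    then show ?thesis by (simp add: cis_conv_exp mult.assoc flip: exp_add)
  qed
  ultimately have "((\<lambda>t. det (M t) * exp (- \<i> * of_real (\<theta> t))) has_vector_derivative
      of_real (R 0) * (\<i> * (Q - of_real \<theta>'))) (at 0)" using real[of 0] \<delta> by simp
  then have "((\<lambda>t. Im (det (M t) * exp (- \<i> * of_real (\<theta> t)))) has_vector_derivative
      Im (of_real (R 0) * (\<i> * (Q - of_real \<theta>')))) (at 0)"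
    by (rule bounded_linear.has_vector_derivative[OF bounded_linear_Im])
  then have "((\<lambda>t. 0) has_vector_derivative Im (of_real (R 0) * (\<i> * (Q - of_real \<theta>')))) (at 0)"
    by (rule has_vector_derivative_transform_within_open[of _ _ _ "ball 0 \<delta>"])
      (use real \<delta> in auto)
  then have "Im (of_real (R 0) * (\<i> * (Q - of_real \<theta>'))) = 0"
    using vector_derivative_unique_at has_vector_derivative_const by blast
  moreover have "R 0 > 0" unfolding R_def by (intro prod_pos) (simp add: add_pos_nonneg)
  ultimately have "\<theta>' = Re Q" by simp
  also have "\<dots> = (\<Sum>i\<in>UNIV. N i i / (1 + (\<mu> i)\<^sup>2))"
    by (simp add: Q_def Re_divide)
  finally show ?thesis .
qed

lemma arctan_le_self:
  assumes "0 \<le> x"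
  shows "arctan x \<le> x"
proof (cases "x = 0")
  case False
  then obtain z where "arctan x - arctan 0 = (x - 0) * inverse (1 + z\<^sup>2)"
    using MVT2[of 0 x arctan "\<lambda>z. inverse (1 + z\<^sup>2)"] DERIV_arctan assms by auto
  moreover have "inverse (1 + z\<^sup>2) \<le> 1"
    using inverse_le_1_iff[of "1 + z\<^sup>2"] by simp
  ultimately show ?thesis
    using mult_left_mono[of "inverse (1 + z\<^sup>2)" 1 x] assms by simp
qed simp

text \<open>Since \<open>arctan\<close> is bounded by \<open>\<pi> / 2\<close>, a negative eigenvalue \<open>\<mu> m\<close> uses up the whole slack in
  the phase condition: the other eigenvalues must compensate for it one by one, and what is left of the
  slack is at most \<open>\<pi> / 2 - arctan (- \<mu> m) = arctan (1 / - \<mu> m)\<close>.\<close>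

lemma supercritical_phase:
  fixes \<mu> :: "'n::finite \<Rightarrow> real"
  assumes phase: "(real CARD('n) - 2) * (pi / 2) \<le> (\<Sum>i\<in>UNIV. arctan (\<mu> i))" and m: "\<mu> m < 0"
  shows "j \<noteq> m \<Longrightarrow> - \<mu> m \<le> \<mu> j"
    and "(\<Sum>i\<in>UNIV. arctan (\<mu> i)) - (real CARD('n) - 2) * (pi / 2) \<le> 1 / - \<mu> m"
proof -
  have le: "(\<Sum>i\<in>S. arctan (\<mu> i)) \<le> real (card S) * (pi / 2)" for S
    using sum_bounded_above[of S "\<lambda>i. arctan (\<mu> i)" "pi / 2"] arctan_ubound less_imp_le by blast
  have split: "(\<Sum>i\<in>UNIV. arctan (\<mu> i)) = arctan (\<mu> m) + (\<Sum>i\<in>UNIV - {m}. arctan (\<mu> i))"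
    by (rule sum.remove) auto
  show "- \<mu> m \<le> \<mu> j" if j: "j \<noteq> m"
  proof -
    have "(\<Sum>i\<in>UNIV - {m}. arctan (\<mu> i)) = arctan (\<mu> j) + (\<Sum>i\<in>UNIV - {m} - {j}. arctan (\<mu> i))"
      using j by (intro sum.remove) auto
    moreover have "real (card (UNIV - {m} - {j})) = real CARD('n) - 2"
    proof -
      have "card {m, j} \<le> CARD('n)" by (intro card_mono) auto
      moreover have "card (UNIV - {m} - {j}) = CARD('n) - card {m, j}"
        by (simp add: card_Diff_subset insert_commute flip: Diff_insert)
      ultimately show ?thesis using j by simp
    qed
    ultimately have "arctan (- \<mu> m) \<le> arctan (\<mu> j)"
      using phase split le[of "UNIV - {m} - {j}"] by (simp add: arctan_minus)
    then show ?thesis by (simp only: arctan_le_iff)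
  qed
  have "real (card (UNIV - {m})) = real CARD('n) - 1"
    by (simp add: card_Diff_singleton of_nat_diff Suc_leI)
  then have "(\<Sum>i\<in>UNIV. arctan (\<mu> i)) - (real CARD('n) - 2) * (pi / 2) \<le> pi / 2 + arctan (\<mu> m)"
    using split le[of "UNIV - {m}"] by (simp add: algebra_simps)
  also have "\<dots> = arctan (1 / - \<mu> m)"
    using arctan_inverse[of "- \<mu> m"] m by (simp add: arctan_minus inverse_eq_divide)
  also have "\<dots> \<le> 1 / - \<mu> m"
    using m by (intro arctan_le_self) simp
  finally show "(\<Sum>i\<in>UNIV. arctan (\<mu> i)) - (real CARD('n) - 2) * (pi / 2) \<le> 1 / - \<mu> m" .
qed

section \<open>The inequality at a maximum point\<close>

text \<open>Jensen's inequality for \<open>1 / y\<close>, obtained by summing the tangent line bound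
  \<open>1 / y \<ge> 2 / T - y / T\<^sup>2\<close> at \<open>T\<close>.\<close>

lemma weighted_mean_inverse_bound:
  fixes y c :: "'n \<Rightarrow> real"
  assumes y: "\<And>i. i \<in> I \<Longrightarrow> y i > 0" and c: "\<And>i. i \<in> I \<Longrightarrow> 0 \<le> c i" "sum c I = 1"
    and T: "(\<Sum>i\<in>I. y i * c i) \<le> T" "T > 0"
  shows "1 / T \<le> (\<Sum>i\<in>I. c i / y i)"
proof -
  have "(2 / T - y i / T\<^sup>2) * c i \<le> c i / y i" if "i \<in> I" for i
  proof -
    have "0 \<le> (1 - y i / T)\<^sup>2 / y i" using y[OF that] by simp
    also have "\<dots> = 1 / y i - (2 / T - y i / T\<^sup>2)"
      using y[OF that] T by (simp add: power2_eq_square field_simps)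
    finally have "(2 / T - y i / T\<^sup>2) * c i \<le> 1 / y i * c i"
      using c(1)[OF that] by (intro mult_right_mono) auto
    then show ?thesis by simp
  qed
  then have "(\<Sum>i\<in>I. (2 / T - y i / T\<^sup>2) * c i) \<le> (\<Sum>i\<in>I. c i / y i)"
    by (rule sum_mono)
  moreover have "(\<Sum>i\<in>I. (2 / T - y i / T\<^sup>2) * c i) = 2 / T * sum c I - (\<Sum>i\<in>I. y i * c i) / T\<^sup>2"
    by (simp add: left_diff_distrib sum_subtractf sum_distrib_left sum_divide_distrib)
  moreover have "(\<Sum>i\<in>I. y i * c i) / T\<^sup>2 \<le> T / T\<^sup>2"
    using T by (intro divide_right_mono) auto
  moreover have "T / T\<^sup>2 = 1 / T" using T by (simp add: power2_eq_square)
  ultimately show ?thesis using c(2) by simp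
qed

text \<open>Here \<open>x i\<close>, \<open>e i\<close> are the coordinates of the maximum point and of the gradient direction in an
  eigenbasis of the Hessian with eigenvalues \<open>\<mu> i\<close>, \<open>p\<close> is the length of the gradient, \<open>\<eta>\<close> the
  cut-off, \<open>a = 2 A U\<close>, and \<open>\<psi>e\<close> the derivative of the phase in the gradient direction. Every weight
  \<open>1 / (1 + (\<mu> i)\<^sup>2)\<close> is at most \<open>\<eta>\<^sup>2 / (4 p\<^sup>2)\<close>, which makes the error terms small. The good term
  survives because \<open>|D\<^sup>2u e| \<le> 10 p / \<eta>\<close>: the vector \<open>e\<close> must put mass on eigenvalues of modulus at
  most of order \<open>p / \<eta>\<close>, so the weighted square of the gradient is at least \<open>\<eta>\<^sup>2 / 101\<close>.\<close>

lemma maximum_point_inequality: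
  fixes x e \<mu> :: "'n::finite \<Rightarrow> real"
  assumes p: "p > 0" and \<eta>: "0 < \<eta>" "\<eta> \<le> 1" and W: "9 \<le> p * \<eta>" and a: "4 \<le> a" "a \<le> 8"
    and A: "A > 0"
    and e: "(\<Sum>i\<in>UNIV. (e i)\<^sup>2) = 1" and x: "(\<Sum>i\<in>UNIV. (x i)\<^sup>2) \<le> 1"
    and xe: "\<bar>\<Sum>i\<in>UNIV. x i * e i\<bar> \<le> 1"
    and first: "\<And>i. \<eta> * (\<mu> i * e i) = p * (2 * x i - a * e i)"
    and phase: "(real CARD('n) - 2) * (pi / 2) \<le> (\<Sum>i\<in>UNIV. arctan (\<mu> i))"
    and semi: "\<And>t. 0 < t \<Longrightarrow> t < \<eta> / 2 \<Longrightarrow>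
      0 \<le> (\<Sum>i\<in>UNIV. arctan (\<mu> i)) - (real CARD('n) - 2) * (pi / 2) + t * \<psi>e + K / 2 * t\<^sup>2"
    and second: "(\<Sum>i\<in>UNIV. (- 2 * p - 4 * x i * (\<mu> i * e i) + 2 * A * (p * e i)\<^sup>2 + a * \<mu> i)
        / (1 + (\<mu> i)\<^sup>2)) + \<eta> * \<psi>e \<le> 0"
  shows "2 * A / 101 * sqrt (p * \<eta>) \<le> 11 * real CARD('n) + 4 + (1 + K) / 2"
proof -
  define g where "g i = 1 / (1 + (\<mu> i)\<^sup>2)" for i
  define n where "n = real CARD('n)"
  define \<phi> where "\<phi> = (\<Sum>i\<in>UNIV. arctan (\<mu> i)) - (real CARD('n) - 2) * (pi / 2)"
  have n: "n \<ge> 1" by (simp add: n_def Suc_leI)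
  have g0: "0 < g i" for i by (simp add: g_def add_pos_nonneg)
  have quadratic_form: "(\<Sum>i\<in>UNIV. \<mu> i * (e i)\<^sup>2) \<le> - 2 * p / \<eta>"
  proof -
    have "\<eta> * (\<Sum>i\<in>UNIV. \<mu> i * (e i)\<^sup>2) = (\<Sum>i\<in>UNIV. e i * (\<eta> * (\<mu> i * e i)))"
      by (simp add: sum_distrib_left power2_eq_square mult_ac)
    also have "\<dots> = (\<Sum>i\<in>UNIV. e i * (p * (2 * x i - a * e i)))" by (simp only: first)
    also have "\<dots> = p * (2 * (\<Sum>i\<in>UNIV. x i * e i) - a * (\<Sum>i\<in>UNIV. (e i)\<^sup>2))"
      by (simp add: sum_distrib_left sum_subtractf power2_eq_square algebra_simps)
    also have "\<dots> \<le> p * (- 2)"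
      using xe a p e by (intro mult_left_mono) auto
    finally show ?thesis using \<eta> by (simp add: field_simps)
  qed
  \<comment> \<open>The value of the quadratic form at the unit vector \<open>e\<close> bounds the smallest eigenvalue.\<close>
  obtain m where m: "\<And>i. \<mu> m \<le> \<mu> i"
  proof -
    have "Min (range \<mu>) \<in> range \<mu>" by (intro Min_in) auto
    then obtain m where "\<mu> m = Min (range \<mu>)" by (metis imageE)
    then show thesis by (intro that[of m]) simp
  qed
  define \<Lambda> where "\<Lambda> = - \<mu> m"
  have \<Lambda>: "2 * p / \<eta> \<le> \<Lambda>"
  proof -
    have "\<mu> m = (\<Sum>i\<in>UNIV. \<mu> m * (e i)\<^sup>2)" using e by (simp flip: sum_distrib_left)
    also have "\<dots> \<le> (\<Sum>i\<in>UNIV. \<mu> i * (e i)\<^sup>2)" by (intro sum_mono mult_right_mono m) auto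
    finally show ?thesis using quadratic_form by (simp add: \<Lambda>_def)
  qed
  have p\<eta>: "0 < 2 * p / \<eta>" using p \<eta> by simp
  then have \<Lambda>0: "\<Lambda> > 0" using \<Lambda> by linarith
  have others: "\<Lambda> \<le> \<mu> j" if "j \<noteq> m" for j
    using supercritical_phase(1)[OF phase _ that] \<Lambda>0 by (simp add: \<Lambda>_def)
  have \<phi>le: "\<phi> \<le> \<eta> / (2 * p)"
  proof -
    have "\<phi> \<le> 1 / \<Lambda>"
      using supercritical_phase(2)[OF phase, of m] \<Lambda>0 by (simp add: \<Lambda>_def \<phi>_def)
    also have "\<dots> \<le> 1 / (2 * p / \<eta>)" by (rule divide_left_mono[OF \<Lambda>]) (use mult_pos_pos[OF \<Lambda>0 p\<eta>] in auto)
    finally show ?thesis by simp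
  qed
  have gle: "g i \<le> \<eta>\<^sup>2 / (4 * p\<^sup>2)" for i
  proof -
    have "\<Lambda> \<le> \<bar>\<mu> i\<bar>" using others[of i] by (cases "i = m") (auto simp: \<Lambda>_def)
    then have "(2 * p / \<eta>)\<^sup>2 \<le> \<bar>\<mu> i\<bar>\<^sup>2" using \<Lambda> p\<eta> by (intro power_mono) auto
    then have "g i \<le> 1 / (2 * p / \<eta>)\<^sup>2"
      unfolding g_def using p\<eta> by (intro divide_left_mono mult_pos_pos) (auto simp: add_pos_nonneg)
    then show ?thesis by (simp add: power_divide power_mult_distrib)
  qed
  have b1: "- n * \<eta> / (2 * p) \<le> (\<Sum>i\<in>UNIV. g i * (- 2 * p))"
  proof -
    have "- \<eta> / (2 * p) \<le> g i * (- 2 * p)" for i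
    proof -
      have "g i * (2 * p) \<le> \<eta>\<^sup>2 / (4 * p\<^sup>2) * (2 * p)" using gle p by (intro mult_right_mono) auto
      also have "\<dots> = \<eta>\<^sup>2 / (2 * p)" using p by (simp add: power2_eq_square field_simps)
      also have "\<dots> \<le> \<eta> / (2 * p)"
        using p \<eta> by (intro divide_right_mono) (auto simp: power2_eq_square mult_left_le)
      finally show ?thesis by simp
    qed
    from sum_mono[of UNIV, OF this] show ?thesis by (simp add: n_def)
  qed
  have bound: "\<bar>\<mu> i * e i\<bar> \<le> 10 * p / \<eta>" and x1: "\<bar>x i\<bar> \<le> 1" for i
  proof -
    have le1: "\<bar>f i\<bar> \<le> 1" if "(\<Sum>i\<in>UNIV. (f i)\<^sup>2) \<le> 1" for f :: "'n \<Rightarrow> real"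
    proof -
      have "(f i)\<^sup>2 \<le> (\<Sum>i\<in>UNIV. (f i)\<^sup>2)" by (rule member_le_sum) auto
      then show ?thesis using that abs_square_le_1[of "f i"] by linarith
    qed
    have x1: "\<bar>x i\<bar> \<le> 1" and e1: "\<bar>e i\<bar> \<le> 1" using le1 x e by auto
    show "\<bar>x i\<bar> \<le> 1" by (rule x1)
    have "\<bar>a * e i\<bar> \<le> 8 * 1" unfolding abs_mult using e1 a by (intro mult_mono) auto
    then have "\<bar>2 * x i - a * e i\<bar> \<le> 10" using x1 by linarith
    then have "\<bar>p * (2 * x i - a * e i)\<bar> \<le> p * 10"
      unfolding abs_mult using p by (intro mult_mono) auto
    then have "\<eta> * \<bar>\<mu> i * e i\<bar> \<le> 10 * p"
      using first[of i] \<eta> by (metis abs_mult abs_of_pos mult.commute)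
    then show "\<bar>\<mu> i * e i\<bar> \<le> 10 * p / \<eta>" using \<eta> by (simp add: field_simps)
  qed
  have b2: "- n * (10 * \<eta> / p) \<le> (\<Sum>i\<in>UNIV. g i * (- 4 * x i * (\<mu> i * e i)))"
  proof -
    have "- (10 * \<eta> / p) \<le> g i * (- 4 * x i * (\<mu> i * e i))" for i
    proof -
      have "\<bar>g i * (- 4 * x i * (\<mu> i * e i))\<bar> = g i * (4 * (\<bar>x i\<bar> * \<bar>\<mu> i * e i\<bar>))"
        using g0[of i] by (simp add: abs_mult)
      also have "\<dots> \<le> \<eta>\<^sup>2 / (4 * p\<^sup>2) * (4 * (1 * (10 * p / \<eta>)))"
        using gle[of i] g0[of i] bound[of i] x1[of i] p \<eta>
        by (intro mult_mono) auto
      also have "\<dots> = 10 * \<eta> / p" using p \<eta> by (simp add: power2_eq_square field_simps)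
      finally show ?thesis by linarith
    qed
    from sum_mono[of UNIV, OF this] show ?thesis by (simp add: n_def)
  qed
  have b3: "2 * A * \<eta>\<^sup>2 / 101 \<le> (\<Sum>i\<in>UNIV. g i * (2 * A * (p * e i)\<^sup>2))"
  proof -
    define T where "T = 101 * p\<^sup>2 / \<eta>\<^sup>2"
    have T0: "T > 0" using p \<eta> by (simp add: T_def)
    have "(\<Sum>i\<in>UNIV. (2 * x i - a * e i)\<^sup>2)
      = (\<Sum>i\<in>UNIV. 4 * (x i)\<^sup>2 - 4 * a * (x i * e i) + a\<^sup>2 * (e i)\<^sup>2)"
      by (intro sum.cong refl) (simp add: power2_eq_square algebra_simps)
    also have "\<dots> = 4 * (\<Sum>i\<in>UNIV. (x i)\<^sup>2) - 4 * a * (\<Sum>i\<in>UNIV. x i * e i) + a\<^sup>2 * (\<Sum>i\<in>UNIV. (e i)\<^sup>2)"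
      by (simp add: sum.distrib sum_subtractf sum_distrib_left)
    also have "\<dots> \<le> 4 + 4 * 8 * 1 + 8\<^sup>2 * 1"
    proof -
      have "\<bar>a * (\<Sum>i\<in>UNIV. x i * e i)\<bar> \<le> 8 * 1" unfolding abs_mult using xe a by (intro mult_mono) auto
      moreover have "a\<^sup>2 \<le> 8\<^sup>2" using a by (intro power_mono) auto
      ultimately show ?thesis using x e by simp
    qed
    finally have 100: "(\<Sum>i\<in>UNIV. (2 * x i - a * e i)\<^sup>2) \<le> 100" by simp
    have eq: "\<mu> i * e i = p / \<eta> * (2 * x i - a * e i)" for i
      using first[of i] \<eta> by (simp add: field_simps)
    have "(\<Sum>i\<in>UNIV. (\<mu> i * e i)\<^sup>2) = (p / \<eta>)\<^sup>2 * (\<Sum>i\<in>UNIV. (2 * x i - a * e i)\<^sup>2)"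
      unfolding eq power_mult_distrib[of "p / \<eta>"] sum_distrib_left ..
    also have "\<dots> \<le> (p / \<eta>)\<^sup>2 * 100" using 100 by (intro mult_left_mono) auto
    finally have "(\<Sum>i\<in>UNIV. (1 + (\<mu> i)\<^sup>2) * (e i)\<^sup>2) \<le> 1 + (p / \<eta>)\<^sup>2 * 100"
      using e by (simp add: algebra_simps sum.distrib power_mult_distrib)
    also have "\<dots> \<le> T"
    proof -
      have "\<eta> \<le> p" using W \<eta> mult_left_le[of \<eta> p] p by linarith
      then have "1 \<le> (p / \<eta>)\<^sup>2" using \<eta> by (intro one_le_power) simp
      then show ?thesis by (simp add: T_def power_divide)
    qed
    finally have "1 / T \<le> (\<Sum>i\<in>UNIV. (e i)\<^sup>2 / (1 + (\<mu> i)\<^sup>2))"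
      using e T0 by (intro weighted_mean_inverse_bound) (auto simp: add_pos_nonneg)
    then have "2 * A * p\<^sup>2 * (1 / T) \<le> 2 * A * p\<^sup>2 * (\<Sum>i\<in>UNIV. (e i)\<^sup>2 / (1 + (\<mu> i)\<^sup>2))"
      using A by (intro mult_left_mono) auto
    also have "\<dots> = (\<Sum>i\<in>UNIV. g i * (2 * A * (p * e i)\<^sup>2))"
      by (simp add: g_def sum_distrib_left power_mult_distrib mult_ac)
    also have "2 * A * p\<^sup>2 * (1 / T) = 2 * A * \<eta>\<^sup>2 / 101"
      using p \<eta> by (simp add: T_def field_simps)
    finally show ?thesis .
  qed
  have b4: "- (4 * \<eta> / p) \<le> (\<Sum>i\<in>UNIV. g i * (a * \<mu> i))"
  proof -
    have "(\<Sum>i\<in>UNIV. g i * (a * \<mu> i)) = g m * (a * \<mu> m) + (\<Sum>i\<in>UNIV - {m}. g i * (a * \<mu> i))"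
      by (rule sum.remove) auto
    moreover have "0 \<le> (\<Sum>i\<in>UNIV - {m}. g i * (a * \<mu> i))"
      using others \<Lambda>0 g0 a by (intro sum_nonneg mult_nonneg_nonneg) (force intro: less_imp_le order_trans)+
    moreover have "- (4 * \<eta> / p) \<le> g m * (a * \<mu> m)"
    proof -
      have "g m * \<Lambda> \<le> 1 / \<Lambda>"
        using \<Lambda>0 by (simp add: g_def \<Lambda>_def[symmetric] power2_eq_square field_simps)
          (simp add: \<Lambda>_def power2_eq_square add_pos_nonneg)
      also have "\<dots> \<le> 1 / (2 * p / \<eta>)" by (rule divide_left_mono[OF \<Lambda>]) (use mult_pos_pos[OF \<Lambda>0 p\<eta>] in auto)
      finally have "a * (g m * \<Lambda>) \<le> 8 * (1 / (2 * p / \<eta>))"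
        using a \<Lambda>0 g0[of m] by (intro mult_mono) auto
      then show ?thesis by (simp add: \<Lambda>_def algebra_simps)
    qed
    ultimately show ?thesis by linarith
  qed
  \<comment> \<open>The step \<open>t\<close> balances the two terms \<open>\<phi> / t\<close> and \<open>K t / 2\<close> in the bound for \<open>- \<psi>e\<close>,
    since \<open>\<phi>\<close> is at most \<open>t\<^sup>2 / 2\<close>; it stays inside the ball because \<open>p \<eta> \<ge> 9\<close>.\<close>
  define t where "t = sqrt (\<eta> / p)"
  define W where "W = p * \<eta>"
  have W0: "9 \<le> W" and sW: "3 \<le> sqrt W"
    using W real_le_rsqrt[of 3 W] by (auto simp: W_def)
  have t2: "t\<^sup>2 = \<eta> / p" and t0: "t > 0" using p \<eta> by (auto simp: t_def)
  have tW: "t = \<eta> / sqrt W"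
    using p \<eta> by (simp add: t_def W_def real_sqrt_divide real_sqrt_mult field_simps)
  have "t < \<eta> / 2" unfolding tW using sW W0 \<eta> by (intro divide_strict_left_mono) auto
  from semi[OF t0 this] have "0 \<le> \<phi> + t * \<psi>e + K / 2 * t\<^sup>2" by (simp add: \<phi>_def)
  also have "\<dots> \<le> t\<^sup>2 / 2 + t * \<psi>e + K / 2 * t\<^sup>2" using \<phi>le by (simp add: t2)
  also have "\<dots> = t * ((1 + K) / 2 * t + \<psi>e)" by (simp add: power2_eq_square field_simps)
  finally have "- ((1 + K) / 2 * t) \<le> \<psi>e" using t0 by (simp add: zero_le_mult_iff)
  then have b5: "- ((1 + K) / 2 * (\<eta> * t)) \<le> \<eta> * \<psi>e"
    using mult_left_mono[of "- ((1 + K) / 2 * t)" \<psi>e \<eta>] \<eta> by (simp add: mult_ac)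
  have "(\<Sum>i\<in>UNIV. g i * (- 2 * p)) + (\<Sum>i\<in>UNIV. g i * (- 4 * x i * (\<mu> i * e i)))
      + (\<Sum>i\<in>UNIV. g i * (2 * A * (p * e i)\<^sup>2)) + (\<Sum>i\<in>UNIV. g i * (a * \<mu> i)) + \<eta> * \<psi>e \<le> 0"
    using second by (simp add: g_def sum.distrib sum_subtractf add_divide_distrib diff_divide_distrib
        sum_negf)
  then have "2 * A * \<eta>\<^sup>2 / 101 \<le> n * \<eta> / (2 * p) + n * (10 * \<eta> / p) + 4 * \<eta> / p + (1 + K) / 2 * (\<eta> * t)"
    using b1 b2 b3 b4 b5 by linarith
  also have "\<dots> = (n / 2 + 10 * n + 4) * t\<^sup>2 + (1 + K) / 2 * (\<eta> * t)"
    using p by (simp add: t2 field_simps)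
  also have "\<dots> = \<eta>\<^sup>2 * ((n / 2 + 10 * n + 4) / (sqrt W)\<^sup>2 + (1 + K) / 2 / sqrt W)"
    by (simp add: tW power2_eq_square field_simps)
  finally have "\<eta>\<^sup>2 * (2 * A / 101) \<le> \<eta>\<^sup>2 * ((n / 2 + 10 * n + 4) / (sqrt W)\<^sup>2 + (1 + K) / 2 / sqrt W)"
    by (simp add: mult_ac)
  then have "2 * A / 101 \<le> (n / 2 + 10 * n + 4) / (sqrt W)\<^sup>2 + (1 + K) / 2 / sqrt W"
    using \<eta> by (subst (asm) mult_le_cancel_left_pos) auto
  then have "2 * A / 101 * sqrt W \<le> ((n / 2 + 10 * n + 4) / (sqrt W)\<^sup>2 + (1 + K) / 2 / sqrt W) * sqrt W"
    using W0 by (intro mult_right_mono) auto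
  also have "\<dots> = (n / 2 + 10 * n + 4) / sqrt W + (1 + K) / 2"
  proof -
    have "(X / r\<^sup>2 + Y / r) * r = X / r + Y" if "r > 0" for X Y r :: real
      using that by (simp add: power2_eq_square field_simps)
    then show ?thesis by this (use W0 in simp)
  qed
  also have "\<dots> \<le> (n / 2 + 10 * n + 4) / 1 + (1 + K) / 2"
    using sW W0 n by (intro add_right_mono divide_left_mono) auto
  also have "\<dots> \<le> 11 * n + 4 + (1 + K) / 2" using n by simp
  finally show ?thesis by (simp add: W_def n_def)
qed

section \<open>From the maximum point to the gradient estimate\<close>

lemma line_in_unit_ball:
  fixes x v :: "'a::real_normed_vector"
  assumes "norm v = 1" "\<bar>t\<bar> < 1 - norm x"
  shows "x + t *\<^sub>R v \<in> ball 0 1"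
  using norm_triangle_ineq[of x "t *\<^sub>R v"] assms by simp

lemma has_real_derivative_inner_line:
  "((\<lambda>s. (x + s *\<^sub>R v) \<bullet> w) has_real_derivative v \<bullet> w) (at t)"
  by (auto simp: inner_add_left intro!: derivative_eq_intros)

lemma has_real_derivative_norm_line:
  "((\<lambda>s. (norm (x + s *\<^sub>R v))\<^sup>2) has_real_derivative 2 * ((x + t *\<^sub>R v) \<bullet> v)) (at t)"
proof -
  have "(norm (x + s *\<^sub>R v))\<^sup>2 = x \<bullet> x + 2 * (x \<bullet> v) * s + v \<bullet> v * s\<^sup>2" for s
    unfolding power2_norm_eq_inner
    by (simp add: inner_add_left inner_add_right inner_commute power2_eq_square algebra_simps)
  then show ?thesis
    by (auto simp: inner_add_left intro!: derivative_eq_intros)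
qed

text \<open>A concave function of one variable lies below its tangent.\<close>

lemma semiconcave_on_line_bound:
  fixes \<psi> :: "real^'n \<Rightarrow> real"
  assumes semi: "semiconcave_on (ball 0 1) K \<psi>" and e: "norm e = 1"
    and d: "((\<lambda>s. \<psi> (x + s *\<^sub>R e)) has_real_derivative d) (at 0)"
    and t: "0 < t" "t < 1 - norm x"
  shows "\<psi> (x + t *\<^sub>R e) \<le> \<psi> x + t * d + K / 2 * t\<^sup>2"
proof -
  define q where "q y = - (\<psi> y - K / 2 * (norm y)\<^sup>2)" for y
  define h where "h s = q (x + s *\<^sub>R e)" for s
  have conv: "convex_on (ball 0 1) q"
    using semi by (simp add: semiconcave_on_def concave_on_def q_def[abs_def])
  have convh: "convex_on (ball 0 (1 - norm x)) h"
  proof (rule convex_onI)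
    fix r a b :: real
    assume r: "0 < r" "r < 1" and ab: "a \<in> ball 0 (1 - norm x)" "b \<in> ball 0 (1 - norm x)"
    have "x + ((1 - r) * a + r * b) *\<^sub>R e = (1 - r) *\<^sub>R (x + a *\<^sub>R e) + r *\<^sub>R (x + b *\<^sub>R e)"
      by (simp add: algebra_simps)
    then have "h ((1 - r) *\<^sub>R a + r *\<^sub>R b) = q ((1 - r) *\<^sub>R (x + a *\<^sub>R e) + r *\<^sub>R (x + b *\<^sub>R e))"
      unfolding h_def real_scaleR_def by (rule arg_cong)
    also have "\<dots> \<le> (1 - r) * h a + r * h b"
      unfolding h_def using r ab by (intro convex_onD[OF conv] line_in_unit_ball e) auto
    finally show "h ((1 - r) *\<^sub>R a + r *\<^sub>R b) \<le> (1 - r) * h a + r * h b" .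
  qed (rule convex_ball)
  have h': "(h has_real_derivative - d + K * (x \<bullet> e)) (at 0)"
    unfolding h_def[abs_def] q_def
    by (rule DERIV_cong[OF DERIV_minus[OF DERIV_diff[OF d
          DERIV_cmult[OF has_real_derivative_norm_line]]]]) simp
  have "(- d + K * (x \<bullet> e)) * (t - 0) \<le> h t - h 0"
    by (rule convex_on_imp_above_tangent[OF convh connected_ball _ _ has_field_derivative_at_within[OF h']])
      (use t in auto)
  moreover have "(norm (x + t *\<^sub>R e))\<^sup>2 = (norm x)\<^sup>2 + 2 * t * (x \<bullet> e) + t\<^sup>2"
  proof -
    have "e \<bullet> e = 1" using e by (simp add: norm_eq_1)
    then show ?thesis unfolding power2_norm_eq_inner
      by (simp add: inner_add_left inner_add_right inner_commute power2_eq_square algebra_simps)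
  qed
  ultimately show ?thesis by (simp add: h_def q_def algebra_simps)
qed

text \<open>For \<open>T\<close> the third derivatives of a function this exchanges one argument of the trilinear form with
  another: \<open>D\<^sub>b D\<^sub>a D\<^sub>c = D\<^sub>a D\<^sub>b D\<^sub>c\<close>.\<close>

lemma sum3_swap_symmetric:
  fixes a b c :: "'n::finite \<Rightarrow> real"
  assumes "\<And>i j k. T i j k = T j i k"
  shows "(\<Sum>i\<in>UNIV. a i * (\<Sum>k\<in>UNIV. (\<Sum>j\<in>UNIV. b j * T j i k) * c k))
       = (\<Sum>i\<in>UNIV. b i * (\<Sum>k\<in>UNIV. (\<Sum>j\<in>UNIV. a j * T j i k) * c k))"
proof -
  have expand: "(\<Sum>i\<in>UNIV. a i * (\<Sum>k\<in>UNIV. (\<Sum>j\<in>UNIV. b j * T j i k) * c k))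
      = (\<Sum>k\<in>UNIV. \<Sum>i\<in>UNIV. \<Sum>j\<in>UNIV. a i * (b j * T j i k) * c k)" for a b :: "'n \<Rightarrow> real"
    by (subst sum.swap) (simp add: sum_distrib_left sum_distrib_right mult_ac)
  have "(\<Sum>i\<in>UNIV. \<Sum>j\<in>UNIV. a i * (b j * T j i k) * c k)
      = (\<Sum>i\<in>UNIV. \<Sum>j\<in>UNIV. b i * (a j * T j i k) * c k)" for k
    by (subst sum.swap) (simp add: assms[of _ _ k] mult_ac)
  then show ?thesis unfolding expand by simp
qed

text \<open>The direction \<open>e\<close> of the gradient at the maximum point is kept fixed, so that \<open>|Du|\<close> is replaced by
  the directional derivative \<open>u\<^sub>e \<le> |Du|\<close>, which is twice differentiable and gives the same value at
  the maximum point.\<close>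

lemma interior_maximum_estimate:
  fixes u \<psi> :: "real^'n \<Rightarrow> real"
  assumes \<psi>: "Ck_on 1 (ball 0 1) \<psi>"
    and phase: "\<forall>x\<in>ball 0 1. \<psi> x \<ge> (real CARD('n) - 2) * (pi / 2)"
    and semi: "semiconcave_on (ball 0 1) K \<psi>"
    and u: "Ck_on 3 (ball 0 1) u"
    and lam: "\<forall>x\<in>ball 0 1. eigenvalues_of (hessian u x) (lam x)"
    and eq: "\<forall>x\<in>ball 0 1. (\<Sum>i\<in>UNIV. arctan (lam x i)) = \<psi> x"
    and x: "x \<in> ball 0 1" and A: "A > 0" and a: "4 \<le> 2 * A * (u x - c)" "2 * A * (u x - c) \<le> 8"
    and max: "\<And>y. y \<in> ball 0 1 \<Longrightarrow> (1 - (norm y)\<^sup>2) * norm (gradient u y) + A * (u y - c)\<^sup>2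
      \<le> (1 - (norm x)\<^sup>2) * norm (gradient u x) + A * (u x - c)\<^sup>2"
    and W: "9 \<le> norm (gradient u x) * (1 - (norm x)\<^sup>2)"
  shows "2 * A / 101 * sqrt (norm (gradient u x) * (1 - (norm x)\<^sup>2)) \<le> 11 * real CARD('n) + 4 + (1 + K) / 2"
proof -
  define S where "S = ball (0 :: real^'n) 1"
  have S: "open S" by (simp add: S_def)
  define G H where "G = gradient u" and "H = hessian u"
  define T where "T i j k = partial i (partial j (partial k u))" for i j k
  define DH where "DH v y = (\<chi> i k. \<Sum>j\<in>UNIV. v $ j * T j i k y)" for v :: "real^'n" and y
  have C2: "Ck_on 2 S (partial k u)" for k
    using u by (simp add: S_def numeral_3_eq_3 numeral_2_eq_2)
  have du: "u differentiable (at y)" "partial k u differentiable (at y)"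
    "partial i (partial k u) differentiable (at y)" if "y \<in> S" for y i k
    using u that by (auto simp: S_def numeral_3_eq_3)
  have Hsym: "H y $ i $ j = H y $ j $ i" if "y \<in> S" for y i j
    using partial_commute[OF S that, of 1 u i j] u
    by (simp add: H_def hessian_def S_def numeral_3_eq_3)
  have Tsym: "T i j k y = T j i k y" if "y \<in> S" for y i j k
    using partial_commute[OF S that, of 0 "partial k u" i j] C2[of k]
    by (simp add: T_def numeral_2_eq_2)
  have in_S: "x + t *\<^sub>R v \<in> S" if "norm v = 1" "\<bar>t\<bar> < 1 - norm x" for t v
    using line_in_unit_ball[OF that] by (simp add: S_def)
  have du_line: "((\<lambda>t. u (x + t *\<^sub>R v)) has_real_derivative v \<bullet> G (x + t *\<^sub>R v)) (at t)"
    if "x + t *\<^sub>R v \<in> S" for t v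
    using has_real_derivative_line[OF du(1)[OF that]] by (simp add: inner_vec_def G_def gradient_def)
  have dG_line: "((\<lambda>t. w \<bullet> G (x + t *\<^sub>R v)) has_real_derivative w \<bullet> (H (x + t *\<^sub>R v) *v v)) (at t)"
    if "x + t *\<^sub>R v \<in> S" for t v w
  proof -
    have "((\<lambda>t. G (x + t *\<^sub>R v) $ k) has_real_derivative (H (x + t *\<^sub>R v) *v v) $ k) (at t)" for k
    proof -
      have "(H (x + t *\<^sub>R v) *v v) $ k = (\<Sum>i\<in>UNIV. v $ i * partial i (partial k u) (x + t *\<^sub>R v))"
        by (simp add: matrix_vector_mult_def Hsym[OF that, of k])
          (simp add: H_def hessian_def mult.commute)
      then show ?thesis
        using has_real_derivative_line[OF du(2)[OF that]] by (simp add: G_def gradient_def)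
    qed
    then show ?thesis
      unfolding inner_vec_def inner_real_def by (intro DERIV_sum DERIV_cmult)
  qed
  have dH_line: "((\<lambda>t. w \<bullet> (H (x + t *\<^sub>R v) *v z)) has_real_derivative w \<bullet> (DH v (x + t *\<^sub>R v) *v z)) (at t)"
    if "x + t *\<^sub>R v \<in> S" for t v w z
  proof -
    have "((\<lambda>t. H (x + t *\<^sub>R v) $ i $ k) has_real_derivative DH v (x + t *\<^sub>R v) $ i $ k) (at t)" for i k
      using has_real_derivative_line[OF du(3)[OF that]] by (simp add: H_def hessian_def DH_def T_def)
    then show ?thesis
      unfolding inner_vec_def inner_real_def matrix_vector_mult_def vec_lambda_beta
      by (intro DERIV_sum DERIV_cmult DERIV_cmult_right)
  qed
  define p where "p = norm (G x)"
  define \<eta> where "\<eta> = 1 - (norm x)\<^sup>2"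
  define e where "e = (1 / p) *\<^sub>R G x"
  have nx: "norm x < 1" using x by simp
  have \<eta>: "0 < \<eta>" "\<eta> \<le> 1" using nx by (auto simp: \<eta>_def power_less_one_iff abs_square_less_1)
  have p: "p > 0"
  proof (rule ccontr)
    assume "\<not> p > 0"
    then have "p = 0" by (simp add: p_def)
    then show False using W by (simp add: p_def G_def)
  qed
  have e: "norm e = 1" using p by (simp add: e_def p_def)
  have Ge: "G x = p *\<^sub>R e" using p by (simp add: e_def)
  have eG: "e \<bullet> G x = p" using e by (simp add: Ge norm_eq_1)
  have "transpose (H x) = H x"
    using Hsym x by (simp add: S_def transpose_def vec_eq_iff)
  from spectral_theorem[OF this] obtain b :: "'n \<Rightarrow> real^'n" and \<mu> where b: "\<And>i j. b i \<bullet> b j = (if i = j then 1 else 0)"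
    and \<mu>: "\<And>i. H x *v b i = \<mu> i *\<^sub>R b i"
    by blast
  have nb: "norm (b i) = 1" for i using b by (simp add: norm_eq_1)
  have \<delta>: "0 < 1 - norm x" using nx by simp
  have xS: "x \<in> S" using x by (simp add: S_def)
  have conditions: "- 2 * (x \<bullet> v) * p + \<eta> * (e \<bullet> (H x *v v)) + 2 * A * (u x - c) * (v \<bullet> G x) = 0"
    "- 2 * p - 4 * (x \<bullet> v) * (e \<bullet> (H x *v v)) + \<eta> * (e \<bullet> (DH v x *v v))
      + 2 * A * ((v \<bullet> G x)\<^sup>2 + (u x - c) * (v \<bullet> (H x *v v))) \<le> 0" if v: "norm v = 1" for v
  proof -
    define \<phi> where "\<phi> t = (1 - (norm (x + t *\<^sub>R v))\<^sup>2) * (e \<bullet> G (x + t *\<^sub>R v))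
      + A * (u (x + t *\<^sub>R v) - c)\<^sup>2" for t
    define \<phi>' where "\<phi>' t = - 2 * ((x + t *\<^sub>R v) \<bullet> v) * (e \<bullet> G (x + t *\<^sub>R v))
      + (1 - (norm (x + t *\<^sub>R v))\<^sup>2) * (e \<bullet> (H (x + t *\<^sub>R v) *v v))
      + 2 * A * (u (x + t *\<^sub>R v) - c) * (v \<bullet> G (x + t *\<^sub>R v))" for t
    have vv: "v \<bullet> v = 1" using v by (simp add: norm_eq_1)
    have 1: "(\<phi> has_real_derivative \<phi>' t) (at t)" if "\<bar>t\<bar> < 1 - norm x" for t
      unfolding \<phi>_def[abs_def] \<phi>'_def
      by (rule DERIV_cong[OF DERIV_add[OF
            DERIV_mult[OF DERIV_diff[OF DERIV_const has_real_derivative_norm_line] dG_line[OF in_S[OF v that]]]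
            DERIV_cmult[OF DERIV_power[OF DERIV_diff[OF du_line[OF in_S[OF v that]] DERIV_const]]]]])
        (simp add: algebra_simps)
    have x0: "x + 0 *\<^sub>R v \<in> S" using xS by simp
    have 2: "(\<phi>' has_real_derivative - 2 * p - 4 * (x \<bullet> v) * (e \<bullet> (H x *v v)) + \<eta> * (e \<bullet> (DH v x *v v))
      + 2 * A * ((v \<bullet> G x)\<^sup>2 + (u x - c) * (v \<bullet> (H x *v v)))) (at 0)"
      unfolding \<phi>'_def[abs_def]
      by (rule DERIV_cong[OF DERIV_add[OF DERIV_add[OF
            DERIV_mult[OF DERIV_cmult[OF has_real_derivative_inner_line] dG_line[OF x0]]
            DERIV_mult[OF DERIV_diff[OF DERIV_const has_real_derivative_norm_line] dH_line[OF x0]]]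
            DERIV_mult[OF DERIV_cmult[OF DERIV_diff[OF du_line[OF x0] DERIV_const]] dG_line[OF x0]]]])
        (simp add: eG vv \<eta>_def power2_eq_square algebra_simps)
    have 3: "\<phi> t \<le> \<phi> 0" if "\<bar>t\<bar> < 1 - norm x" for t
    proof -
      let ?y = "x + t *\<^sub>R v"
      have y: "?y \<in> ball 0 1" using in_S[OF v that] by (simp add: S_def)
      then have "0 \<le> 1 - (norm ?y)\<^sup>2" by (simp add: abs_square_le_1)
      moreover have "e \<bullet> G ?y \<le> norm (G ?y)"
        using norm_cauchy_schwarz[of e "G ?y"] e by simp
      ultimately have "(1 - (norm ?y)\<^sup>2) * (e \<bullet> G ?y) \<le> (1 - (norm ?y)\<^sup>2) * norm (G ?y)"
        by (rule mult_left_mono[rotated])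
      then have "\<phi> t \<le> (1 - (norm x)\<^sup>2) * p + A * (u x - c)\<^sup>2"
        using max[OF y] by (simp add: \<phi>_def G_def p_def)
      then show ?thesis by (simp add: \<phi>_def eG)
    qed
    note test = second_derivative_test_max[OF \<delta> 1 2 3]
    show "- 2 * (x \<bullet> v) * p + \<eta> * (e \<bullet> (H x *v v)) + 2 * A * (u x - c) * (v \<bullet> G x) = 0"
      using test(1) by (simp add: \<phi>'_def eG \<eta>_def)
    show "- 2 * p - 4 * (x \<bullet> v) * (e \<bullet> (H x *v v)) + \<eta> * (e \<bullet> (DH v x *v v))
      + 2 * A * ((v \<bullet> G x)\<^sup>2 + (u x - c) * (v \<bullet> (H x *v v))) \<le> 0"
      using test(2) by simp
  qed
  have bG: "b i \<bullet> G x = p * (e \<bullet> b i)" for i by (simp add: Ge inner_commute)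
  define \<psi>e where "\<psi>e = (\<Sum>i\<in>UNIV. e $ i * partial i \<psi> x)"
  have d\<psi>: "((\<lambda>t. \<psi> (x + t *\<^sub>R e)) has_real_derivative \<psi>e) (at 0)"
    using has_real_derivative_line[of \<psi> x 0 e] \<psi> x by (simp add: \<psi>e_def)
  have linearised: "\<psi>e = (\<Sum>i\<in>UNIV. (e \<bullet> (DH (b i) x *v b i)) / (1 + (\<mu> i)\<^sup>2))"
  proof -
    define M where "M t = (\<chi> i j. b i \<bullet> (H (x + t *\<^sub>R e) *v b j))" for t
    have eig: "eigenvalues_of (M t) (lam (x + t *\<^sub>R e))" if "\<bar>t\<bar> < 1 - norm x" for t
      unfolding M_def using in_S[OF e that] lam
      by (intro eigenvalues_of_orthonormal_basis b) (simp add: H_def S_def)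
    have d\<theta>: "((\<lambda>t. \<Sum>i\<in>UNIV. arctan (lam (x + t *\<^sub>R e) i)) has_real_derivative \<psi>e) (at 0)"
    proof (rule has_field_derivative_transform_within_open[OF d\<psi>, of "ball 0 (1 - norm x)"])
      show "\<psi> (x + t *\<^sub>R e) = (\<Sum>i\<in>UNIV. arctan (lam (x + t *\<^sub>R e) i))" if "t \<in> ball 0 (1 - norm x)" for t
        using in_S[OF e, of t] that eq by (simp add: S_def)
    qed (use \<delta> in auto)
    have dM: "((\<lambda>t. M t $ i $ j) has_real_derivative b i \<bullet> (DH e x *v b j)) (at 0)" for i j
      using dH_line[of 0 e "b i" "b j"] xS by (simp add: M_def)
    have M0: "M 0 = (\<chi> i j. if i = j then \<mu> i else 0)"
      by (simp add: M_def \<mu> b vec_eq_iff)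
    have "\<psi>e = (\<Sum>i\<in>UNIV. (b i \<bullet> (DH e x *v b i)) / (1 + (\<mu> i)\<^sup>2))"
      by (rule phase_derivative[OF \<delta> _ d\<theta> dM M0]) (rule eig)
    moreover have "b i \<bullet> (DH e x *v b i) = e \<bullet> (DH (b i) x *v b i)" for i
      unfolding inner_vec_def inner_real_def matrix_vector_mult_def DH_def vec_lambda_beta
      by (rule sum3_swap_symmetric) (rule Tsym[OF xS])
    ultimately show ?thesis by simp
  qed
  have phase_eq: "(\<Sum>i\<in>UNIV. arctan (\<mu> i)) = \<psi> x"
  proof -
    have "eigenvalues_of (\<chi> i j. b i \<bullet> (H x *v b j)) (lam x)"
      using lam x by (intro eigenvalues_of_orthonormal_basis b) (simp add: H_def)
    moreover have "(\<chi> i j. b i \<bullet> (H x *v b j)) = (\<chi> i j. if i = j then \<mu> i else 0)"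
      by (simp add: \<mu> b vec_eq_iff)
    ultimately have "eigenvalues_of (\<chi> i j. if i = j then \<mu> i else 0) (lam x)" by simp
    from eigenvalues_of_sum_unique[OF eigenvalues_of_diagonal this, of arctan]
    show ?thesis using eq x by simp
  qed
  have He: "e \<bullet> (H x *v b i) = \<mu> i * (e \<bullet> b i)" for i by (simp add: \<mu>)
  have "2 * A / 101 * sqrt (p * \<eta>) \<le> 11 * real CARD('n) + 4 + (1 + K) / 2"
  proof (rule maximum_point_inequality[where x = "\<lambda>i. x \<bullet> b i" and e = "\<lambda>i. e \<bullet> b i"
        and \<mu> = \<mu> and a = "2 * A * (u x - c)" and \<psi>e = \<psi>e])
    show "9 \<le> p * \<eta>" using W by (simp add: p_def \<eta>_def G_def)
    show "(\<Sum>i\<in>UNIV. (e \<bullet> b i)\<^sup>2) = 1"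
      using orthonormal_expansion[OF b, of e e] e by (simp add: norm_eq_1 power2_eq_square)
    show "(\<Sum>i\<in>UNIV. (x \<bullet> b i)\<^sup>2) \<le> 1"
      unfolding power2_eq_square[of "x \<bullet> _"]
      using orthonormal_expansion[OF b, of x x] \<eta>(1) dot_square_norm[of x]
      unfolding \<eta>_def by linarith
    show "\<bar>\<Sum>i\<in>UNIV. (x \<bullet> b i) * (e \<bullet> b i)\<bar> \<le> 1"
      using orthonormal_expansion[OF b, of x e] Cauchy_Schwarz_ineq2[of x e] nx e by simp
    show "\<eta> * (\<mu> i * (e \<bullet> b i)) = p * (2 * (x \<bullet> b i) - 2 * A * (u x - c) * (e \<bullet> b i))" for i
      using conditions(1)[OF nb[of i]] unfolding He bG by (simp add: algebra_simps)
    show "(real CARD('n) - 2) * (pi / 2) \<le> (\<Sum>i\<in>UNIV. arctan (\<mu> i))"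
      using phase x by (simp add: phase_eq)
    show "0 \<le> (\<Sum>i\<in>UNIV. arctan (\<mu> i)) - (real CARD('n) - 2) * (pi / 2) + t * \<psi>e + K / 2 * t\<^sup>2"
      if t: "0 < t" "t < \<eta> / 2" for t
    proof -
      have "\<eta> = (1 - norm x) * (1 + norm x)" by (simp add: \<eta>_def power2_eq_square algebra_simps)
      also have "\<dots> \<le> (1 - norm x) * 2" using nx by (intro mult_left_mono) auto
      finally have t': "t < 1 - norm x" using t by simp
      have "x + t *\<^sub>R e \<in> ball 0 1" using line_in_unit_ball[OF e] t t' by simp
      then have "(real CARD('n) - 2) * (pi / 2) \<le> \<psi> (x + t *\<^sub>R e)" using phase by blast
      then show ?thesis
        using semiconcave_on_line_bound[OF semi e d\<psi> t(1) t'] by (simp add: phase_eq)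
    qed
    have "(\<Sum>i\<in>UNIV. (- 2 * p - 4 * (x \<bullet> b i) * (\<mu> i * (e \<bullet> b i)) + 2 * A * (p * (e \<bullet> b i))\<^sup>2
        + 2 * A * (u x - c) * \<mu> i) / (1 + (\<mu> i)\<^sup>2)) + \<eta> * \<psi>e
      = (\<Sum>i\<in>UNIV. (- 2 * p - 4 * (x \<bullet> b i) * (\<mu> i * (e \<bullet> b i)) + \<eta> * (e \<bullet> (DH (b i) x *v b i))
        + 2 * A * ((p * (e \<bullet> b i))\<^sup>2 + (u x - c) * \<mu> i)) / (1 + (\<mu> i)\<^sup>2))"
      unfolding linearised sum_distrib_left sum.distrib[symmetric]
      by (intro sum.cong refl) (simp add: add_divide_distrib[symmetric] algebra_simps)
    also have "\<dots> \<le> 0"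
    proof (intro sum_nonpos divide_nonpos_pos)
      fix i
      show "0 < 1 + (\<mu> i)\<^sup>2" by (simp add: add_pos_nonneg)
      show "- 2 * p - 4 * (x \<bullet> b i) * (\<mu> i * (e \<bullet> b i)) + \<eta> * (e \<bullet> (DH (b i) x *v b i))
        + 2 * A * ((p * (e \<bullet> b i))\<^sup>2 + (u x - c) * \<mu> i) \<le> 0"
        using conditions(2)[OF nb[of i]] unfolding He bG by (simp add: \<mu> b)
    qed
    finally show "(\<Sum>i\<in>UNIV. (- 2 * p - 4 * (x \<bullet> b i) * (\<mu> i * (e \<bullet> b i)) + 2 * A * (p * (e \<bullet> b i))\<^sup>2
        + 2 * A * (u x - c) * \<mu> i) / (1 + (\<mu> i)\<^sup>2)) + \<eta> * \<psi>e \<le> 0" .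
  qed (use p \<eta> a A in auto)
  then show ?thesis by (simp add: p_def \<eta>_def G_def)
qed

lemma Ck_closure_bounded:
  assumes "Ck_closure k S f" "bounded S"
  shows "bounded (f ` S)"
proof -
  obtain g where g: "continuous_on (closure S) g" "\<forall>x\<in>S. g x = f x"
    using assms(1) by (cases k) auto
  have "bounded (g ` closure S)"
    using g(1) assms(2) by (intro compact_imp_bounded compact_continuous_image) auto
  then have "bounded (g ` S)" by (rule bounded_subset) (use closure_subset in auto)
  then show ?thesis using g(2) by (simp cong: image_cong)
qed

lemma gradient_bounded:
  assumes "Ck_closure (Suc k) S u" "bounded S"
  obtains L where "L > 0" "\<And>x. x \<in> S \<Longrightarrow> norm (gradient u x) \<le> L"
proof -
  have "\<exists>c. \<forall>x\<in>S. \<bar>partial i u x\<bar> \<le> c" for i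
    using Ck_closure_bounded[of k S "partial i u"] assms by (auto simp: bounded_iff)
  then obtain c where c: "\<And>i x. x \<in> S \<Longrightarrow> \<bar>partial i u x\<bar> \<le> c i" by metis
  have "norm (gradient u x) \<le> \<bar>\<Sum>i\<in>UNIV. c i\<bar> + 1" if "x \<in> S" for x
  proof -
    have "norm (gradient u x) \<le> (\<Sum>i\<in>UNIV. \<bar>gradient u x $ i\<bar>)" by (rule norm_le_l1_cart)
    also have "\<dots> \<le> (\<Sum>i\<in>UNIV. c i)" using c[OF that] by (intro sum_mono) (simp add: gradient_def)
    finally show ?thesis by linarith
  qed
  then show thesis by (intro that[of "\<bar>\<Sum>i\<in>UNIV. c i\<bar> + 1"]) auto
qed

text \<open>If \<open>|Du(0)| \<le> 8 M\<close>, nothing has to be shown. Otherwise \<open>w 0\<close> exceeds \<open>8 M\<close>, whereas its limits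
  at the boundary are at most \<open>8 M\<close>, so the maximum is attained in the interior.\<close>

lemma gradient_estimate:
  fixes u \<psi> :: "real^'n \<Rightarrow> real"
  assumes \<psi>: "Ck_on 1 (ball 0 1) \<psi>"
    and phase: "\<forall>x\<in>ball 0 1. \<psi> x \<ge> (real CARD('n) - 2) * (pi / 2)"
    and semi: "semiconcave_on (ball 0 1) K \<psi>"
    and u: "Ck_closure 3 (ball 0 1) u"
    and lam: "\<forall>x\<in>ball 0 1. eigenvalues_of (hessian u x) (lam x)"
    and eq: "\<forall>x\<in>ball 0 1. (\<Sum>i\<in>UNIV. arctan (lam x i)) = \<psi> x"
  defines "B \<equiv> 11 * real CARD('n) + 4 + (1 + K) / 2" and "M \<equiv> 1 + osc (ball 0 1) u"
  shows "norm (gradient u 0) \<le> 8 * M + 9 + (101 * B / 4 * M)\<^sup>2"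
proof (cases "norm (gradient u 0) \<le> 8 * M")
  case True
  then show ?thesis using zero_le_power2[of "101 * B / 4 * M"] by linarith
next
  case False
  define S where "S = ball (0 :: real^'n) 1"
  have "bounded (u ` S)" using Ck_closure_bounded[OF u] by (simp add: S_def)
  then have bdd: "bdd_above (u ` S)" "bdd_below (u ` S)"
    by (auto intro: bounded_imp_bdd_above bounded_imp_bdd_below)
  have S0: "0 \<in> S" by (simp add: S_def)
  have inf: "(INF y\<in>S. u y) \<le> u y" and sup: "u y \<le> (SUP y\<in>S. u y)" if "y \<in> S" for y
    using that bdd by (auto intro: cINF_lower cSUP_upper)
  have M1: "1 \<le> M" using inf[OF S0] sup[OF S0] by (simp add: M_def osc_def S_def)
  define c where "c = (INF y\<in>S. u y) - M"
  have U: "M \<le> u y - c" "u y - c \<le> 2 * M" if "y \<in> S" for y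
    using inf[OF that] sup[OF that] by (auto simp: c_def M_def osc_def S_def)
  define A where "A = 2 / M"
  have A: "A > 0" using M1 by (simp add: A_def)
  define w where "w y = (1 - (norm y)\<^sup>2) * norm (gradient u y) + A * (u y - c)\<^sup>2" for y
  have AU: "A * (u y - c)\<^sup>2 \<le> 8 * M" if "y \<in> S" for y
  proof -
    have "(u y - c)\<^sup>2 \<le> (2 * M)\<^sup>2" using U[OF that] M1 by (intro power_mono) auto
    then have "A * (u y - c)\<^sup>2 \<le> A * (2 * M)\<^sup>2" using A by (intro mult_left_mono) auto
    also have "\<dots> = 8 * M" using M1 by (simp add: A_def power2_eq_square)
    finally show ?thesis .
  qed
  have Ck: "Ck_on 3 S u" using Ck_closure_imp_Ck_on[OF u] by (simp add: S_def)
  have contG: "continuous_on S (gradient u)"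
  proof -
    have "continuous_on S (partial i u)" for i using Ck by (simp add: numeral_3_eq_3)
    then show ?thesis unfolding gradient_def[abs_def] by (rule continuous_on_vec_lambda)
  qed
  have contu: "continuous_on S u" using Ck by (simp add: numeral_3_eq_3)
  have cont: "continuous_on S w"
    unfolding w_def by (intro continuous_intros contG contu)
  obtain L where L: "L > 0" "\<And>y. y \<in> S \<Longrightarrow> norm (gradient u y) \<le> L"
    using gradient_bounded[of 2 S u] u by (auto simp: S_def numeral_3_eq_3 numeral_2_eq_2)
  define s where "s = norm (gradient u 0) - 8 * M"
  have s: "s > 0" using False by (simp add: s_def)
  define d where "d = min (1 / 2) (s / (2 * L))"
  have d: "0 < d" "d \<le> 1 / 2" "2 * d * L \<le> s"
    using s L(1) by (auto simp: d_def min_def field_simps)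
  have w0: "norm (gradient u 0) \<le> w 0" using A by (simp add: w_def)
  \<comment> \<open>The width \<open>d\<close> is such that \<open>\<eta> |Du| \<le> 2 d L \<le> s\<close> in the boundary layer.\<close>
  have outside: "w y \<le> w 0" if y: "y \<in> S" "1 - d < norm y" for y
  proof -
    have n1: "norm y < 1" using y by (simp add: S_def)
    have "1 - (norm y)\<^sup>2 = (1 - norm y) * (1 + norm y)" by (simp add: power2_eq_square algebra_simps)
    also have "\<dots> \<le> d * 2" using n1 y by (intro mult_mono) auto
    finally have "(1 - (norm y)\<^sup>2) * norm (gradient u y) \<le> d * 2 * L"
      using L(2)[OF y(1)] d by (intro mult_mono) auto
    then have "w y \<le> s + 8 * M" using d AU[OF y(1)] by (simp add: w_def)
    then show ?thesis using w0 by (simp add: s_def)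
  qed
  have sub: "cball 0 (1 - d) \<subseteq> S" using d by (auto simp: S_def)
  have "cball (0 :: real^'n) (1 - d) \<noteq> {}" using d by simp
  from continuous_attains_sup[OF compact_cball this continuous_on_subset[OF cont sub]]
  obtain x where x: "x \<in> cball 0 (1 - d)" and xmax: "\<And>y. y \<in> cball 0 (1 - d) \<Longrightarrow> w y \<le> w x"
    by blast
  have xS: "x \<in> S" using x sub by blast
  have max: "w y \<le> w x" if "y \<in> S" for y
  proof (cases "norm y \<le> 1 - d")
    case True
    then show ?thesis using xmax by simp
  next
    case False
    then show ?thesis using outside[OF that] xmax[of 0] d by simp
  qed
  define W where "W = norm (gradient u x) * (1 - (norm x)\<^sup>2)"
  have "W \<le> 9 + (101 * B / 4 * M)\<^sup>2"
  proof (cases "9 \<le> W")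
    case True
    have "2 * A / 101 * sqrt W \<le> B"
      unfolding B_def W_def
    proof (rule interior_maximum_estimate[OF \<psi> phase semi _ lam eq])
      show "4 \<le> 2 * A * (u x - c)" "2 * A * (u x - c) \<le> 8"
        using U[OF xS] M1 by (auto simp: A_def field_simps)
      show "(1 - (norm y)\<^sup>2) * norm (gradient u y) + A * (u y - c)\<^sup>2
        \<le> (1 - (norm x)\<^sup>2) * norm (gradient u x) + A * (u x - c)\<^sup>2" if "y \<in> ball 0 1" for y
        using max[of y] that by (simp add: w_def S_def)
    qed (use Ck xS A True in \<open>auto simp: S_def W_def\<close>)
    then have "sqrt W \<le> 101 * B / 4 * M" using M1 by (simp add: A_def field_simps)
    then have "(sqrt W)\<^sup>2 \<le> (101 * B / 4 * M)\<^sup>2" using True by (intro power_mono) auto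
    then show ?thesis using True by simp
  next
    case False
    then show ?thesis using zero_le_power2[of "101 * B / 4 * M"] by linarith
  qed
  moreover have "w x \<le> W + 8 * M" using AU[OF xS] by (simp add: w_def W_def mult.commute)
  ultimately show ?thesis using w0 max[OF S0] by linarith
qed

theorem mainTheorem4:
  fixes K :: real
  assumes "K > 0"
  shows "\<exists>C::real. \<forall>(\<psi> :: real^'n \<Rightarrow> real) (u :: real^'n \<Rightarrow> real) (lam :: real^'n \<Rightarrow> 'n \<Rightarrow> real).
    Ck_on 1 (ball 0 1) \<psi> \<longrightarrow>
    (\<forall>x\<in>ball 0 1. \<psi> x \<ge> (real CARD('n) - 2) * (pi / 2)) \<longrightarrow>
    semiconcave_on (ball 0 1) K \<psi> \<longrightarrow>
    Ck_closure 3 (ball 0 1) u \<longrightarrow>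
    (\<forall>x\<in>ball 0 1. eigenvalues_of (hessian u x) (lam x)) \<longrightarrow>
    (\<forall>x\<in>ball 0 1. (\<Sum>i\<in>UNIV. arctan (lam x i)) = \<psi> x) \<longrightarrow>
    norm (gradient u 0) \<le> C * (1 + (osc (ball 0 1) u)\<^sup>2)"
proof -
  define B where "B = 11 * real CARD('n) + 4 + (1 + K) / 2"
  show ?thesis
  proof (intro exI[of _ "25 + 2 * (101 * B / 4)\<^sup>2"] allI impI)
    fix \<psi> u :: "real^'n \<Rightarrow> real" and lam :: "real^'n \<Rightarrow> 'n \<Rightarrow> real"
    define r where "r = osc (ball 0 1) u"
    assume "Ck_on 1 (ball 0 1) \<psi>"
      and "\<forall>x\<in>ball 0 1. \<psi> x \<ge> (real CARD('n) - 2) * (pi / 2)"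
      and "semiconcave_on (ball 0 1) K \<psi>"
      and "Ck_closure 3 (ball 0 1) u"
      and "\<forall>x\<in>ball 0 1. eigenvalues_of (hessian u x) (lam x)"
      and "\<forall>x\<in>ball 0 1. (\<Sum>i\<in>UNIV. arctan (lam x i)) = \<psi> x"
    then have "norm (gradient u 0) \<le> 8 * (1 + r) + 9 + (101 * B / 4 * (1 + r))\<^sup>2"
      unfolding B_def r_def by (intro gradient_estimate)
    also have "\<dots> = 8 * (1 + r) + 9 + (101 * B / 4)\<^sup>2 * (1 + r)\<^sup>2"
      by (simp only: power_mult_distrib)
    also have "\<dots> \<le> 16 * (1 + r\<^sup>2) + 9 * (1 + r\<^sup>2) + (101 * B / 4)\<^sup>2 * (2 * (1 + r\<^sup>2))"
    proof (intro add_mono mult_left_mono)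
      have "0 \<le> (1 - r)\<^sup>2" by simp
      then have r: "2 * r \<le> 1 + r\<^sup>2" by (simp add: power2_eq_square algebra_simps)
      then show "(1 + r)\<^sup>2 \<le> 2 * (1 + r\<^sup>2)" by (simp add: power2_eq_square algebra_simps)
      show "8 * (1 + r) \<le> 16 * (1 + r\<^sup>2)" using r zero_le_power2[of r] by argo
    qed auto
    also have "\<dots> = (25 + 2 * (101 * B / 4)\<^sup>2) * (1 + r\<^sup>2)" by (simp add: algebra_simps)
    finally show "norm (gradient u 0) \<le> (25 + 2 * (101 * B / 4)\<^sup>2) * (1 + (osc (ball 0 1) u)\<^sup>2)"
      by (simp add: r_def)
  qed
qed

end
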